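(* Let $0<\beta<1$ and $\lambda,\alpha,p>0$. Let $\{N_\beta(t,\lambda)\}_{t\ge0}$ be the fractional Poisson process and $\{Y(t)\}_{t\ge0}$ an independent gamma subordinator with $Y(t)\sim G(\alpha,pt)$. Then the fractional negative binomial process (FNBP) $\{Q_\beta(t)\}_{t\ge0}$, $Q_\beta(t)=N_\beta(Y(t),\lambda)$, has the long-range dependence (LRD) property.
   Context: Fractional Poisson process (FPP): for $0<\beta<1$ and $\lambda>0$, the FPP $\{N_\beta(t,\lambda)\}_{t\ge0}$ is the process whose marginal probabilities $p_\beta(n|t,\lambda)=\mathbb{P}[N_\beta(t,\lambda)=n]$ satisfy $D_t^\beta p_\beta(n|t,\lambda)=-\lambda p_\beta(n|t,\lambda)+\lambda p_\beta(n-1|t,\lambda)$ for $n\ge1$ and $D_t^\beta p_\beta(0|t,\lambda)=-\lambda p_\beta(0|t,\lambda)$, with $p_\beta(n|0,\lambda)=1$ if $n=0$ and $0$ if $n\ge1$. Here $D_t^\beta f(t)=\frac{1}{\Gamma(1-\beta)}\int_0^t\frac{f'(s)}{(t-s)^\beta}\,ds$ is the Caputo derivative. As a process it is given by $N_\beta(t,\lambda)=N(E_\beta(t),\lambda)$ (equality of finite-dimensional distributions), where $\{N(t,\lambda)\}_{t\ge0}$ is a Poisson process with rate $\lambda$ and $\{E_\beta(t)\}_{t\ge0}$ is an independent inverse $\beta$-stable subordinator: $E_\beta(t)=\inf\{r\ge0: D_\beta(r)>t\}$, with $D_\beta$ the $\beta$-stable subordinator satisfying $\mathbb{E}[e^{-uD_\beta(r)}]=e^{-ru^\beta}$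 for $u\geq 0$. Gamma subordinator: for $\alpha,p>0$, $\{Y(t)\}_{t\ge0}$ is the a.s. increasing process with $Y(0)=0$ and stationary independent increments such that, for $t>0$, $Y(t)\sim G(\alpha,pt)$ has density $g(y|\alpha,pt)=\frac{\alpha^{pt}}{\Gamma(pt)}y^{pt-1}e^{-\alpha y}$, $y>0$. LRD/SRD: suppose that for a process $\{X(t)\}_{t\ge0}$ there is an exponent $d>0$ such that for each fixed $s>0$ there is a constant $c(s)>0$ with $\lim_{t\to\infty}\frac{\mathrm{Corr}[X(s),X(t)]}{t^{-d}}=c(s)$. Then $\{X(t)\}_{t\geq 0}$ has the long-range dependence (LRD) property if $d\in(0,1)$, and the short-range dependence (SRD) property if $d\in(1,2)$.
   Formalization: The fractional Poisson process is additionally assumed to have almost surely right-continuous paths; finite-dimensional distributions alone do not determine its value at the random time Y(t), and the claim fails for irregular modifications. *)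

theory Defs
  imports "HOL-Probability.Probability"
begin

text \<open>
  A process is a family \<open>X :: real \<Rightarrow> 'a \<Rightarrow> 's\<close>, of which only the time parameters \<open>t \<ge> 0\<close>
  are used. Measurability of the time-marginals is always with respect to the given
  sigma-algebra \<open>M\<close>, which is not assumed to be complete.
\<close>

definition process :: "'a measure \<Rightarrow> 's measure \<Rightarrow> (real \<Rightarrow> 'a \<Rightarrow> 's) \<Rightarrow> bool" where
  "process M S X \<longleftrightarrow> (\<forall>t\<ge>0. X t \<in> measurable M S)"

definition same_fdd :: "'a measure \<Rightarrow> (real \<Rightarrow> 'a \<Rightarrow> 's) \<Rightarrow> 'b measure \<Rightarrow> (real \<Rightarrow> 'b \<Rightarrow> 's)
    \<Rightarrow> 's measure \<Rightarrow> bool" where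
  "same_fdd M X L Z S \<longleftrightarrow>
     process M S X \<and> process L S Z \<and>
     (\<forall>J. finite J \<and> J \<subseteq> {0..} \<longrightarrow>
        distr M (PiM J (\<lambda>_. S)) (\<lambda>\<omega>. \<lambda>t\<in>J. X t \<omega>) =
        distr L (PiM J (\<lambda>_. S)) (\<lambda>\<omega>. \<lambda>t\<in>J. Z t \<omega>))"

text \<open>
  Independence of the sigma-algebras generated by two entire processes. The library's
  \<open>indep_var\<close> needs both variables to have the same type; integer-valued processes are
  therefore embedded into the reals before this notion is applied.
\<close>

definition independent_processes ::
    "'a measure \<Rightarrow> (real \<Rightarrow> 'a \<Rightarrow> real) \<Rightarrow> (real \<Rightarrow> 'a \<Rightarrow> real) \<Rightarrow> bool" where
  "independent_processes M X Y \<longleftrightarrow>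
     prob_space.indep_var M
       (PiM {0..} (\<lambda>_. borel)) (\<lambda>\<omega>. \<lambda>t\<in>{0..}. X t \<omega>)
       (PiM {0..} (\<lambda>_. borel)) (\<lambda>\<omega>. \<lambda>t\<in>{0..}. Y t \<omega>)"

definition independent_increments :: "'a measure \<Rightarrow> (real \<Rightarrow> 'a \<Rightarrow> real) \<Rightarrow> bool" where
  "independent_increments M X \<longleftrightarrow>
     (\<forall>(n::nat) (\<tau>::nat \<Rightarrow> real). 0 \<le> \<tau> 0 \<and> (\<forall>i<n. \<tau> i < \<tau> (Suc i)) \<longrightarrow>
        prob_space.indep_vars M (\<lambda>_. borel) (\<lambda>i \<omega>. X (\<tau> (Suc i)) \<omega> - X (\<tau> i) \<omega>) {..<n})"

definition stationary_increments :: "'a measure \<Rightarrow> (real \<Rightarrow> 'a \<Rightarrow> real) \<Rightarrow> bool" where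
  "stationary_increments M X \<longleftrightarrow>
     (\<forall>s\<ge>0. \<forall>h\<ge>0. distr M borel (\<lambda>\<omega>. X (s + h) \<omega> - X s \<omega>) =
                   distr M borel (\<lambda>\<omega>. X h \<omega> - X 0 \<omega>))"

definition right_continuous_paths ::
    "'a measure \<Rightarrow> (real \<Rightarrow> 'a \<Rightarrow> 's::topological_space) \<Rightarrow> bool" where
  "right_continuous_paths M X \<longleftrightarrow>
     (AE \<omega> in M. \<forall>t\<ge>0. continuous (at_right t) (\<lambda>s. X s \<omega>))"

text \<open>
  Right-continuity is not part of this definition; it is not needed for what follows, and
  a version satisfying it always exists.
\<close>

definition subordinator :: "'a measure \<Rightarrow> (real \<Rightarrow> 'a \<Rightarrow> real) \<Rightarrow> bool" where
  "subordinator M X \<longleftrightarrow>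
     process M borel X \<and>
     (AE \<omega> in M. X 0 \<omega> = 0) \<and>
     (AE \<omega> in M. mono_on {0..} (\<lambda>t. X t \<omega>)) \<and>
     independent_increments M X \<and>
     stationary_increments M X"

definition gamma_density :: "real \<Rightarrow> real \<Rightarrow> real \<Rightarrow> real" where
  "gamma_density a b y =
     (if y > 0 then a powr b / Gamma b * y powr (b - 1) * exp (- a * y) else 0)"

definition gamma_subordinator ::
    "real \<Rightarrow> real \<Rightarrow> 'a measure \<Rightarrow> (real \<Rightarrow> 'a \<Rightarrow> real) \<Rightarrow> bool" where
  "gamma_subordinator \<alpha> p M Y \<longleftrightarrow>
     subordinator M Y \<and>
     (\<forall>t>0. distributed M lborel (Y t) (\<lambda>y. ennreal (gamma_density \<alpha> (p * t) y)))"

definition stable_subordinator ::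
    "real \<Rightarrow> 'a measure \<Rightarrow> (real \<Rightarrow> 'a \<Rightarrow> real) \<Rightarrow> bool" where
  "stable_subordinator \<beta> M D \<longleftrightarrow>
     subordinator M D \<and>
     (\<forall>r\<ge>0. \<forall>u\<ge>0. (LINT \<omega>|M. exp (- u * D r \<omega>)) = exp (- r * u powr \<beta>))"

definition inverse_stable_subordinator ::
    "real \<Rightarrow> 'a measure \<Rightarrow> (real \<Rightarrow> 'a \<Rightarrow> real) \<Rightarrow> bool" where
  "inverse_stable_subordinator \<beta> M E \<longleftrightarrow>
     process M borel E \<and>
     (\<exists>D. stable_subordinator \<beta> M D \<and>
          (AE \<omega> in M. \<forall>t\<ge>0. E t \<omega> = Inf {r. 0 \<le> r \<and> D r \<omega> > t}))"

definition poisson_process ::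
    "real \<Rightarrow> 'a measure \<Rightarrow> (real \<Rightarrow> 'a \<Rightarrow> nat) \<Rightarrow> bool" where
  "poisson_process rate M N \<longleftrightarrow>
     process M (count_space UNIV) N \<and>
     (AE \<omega> in M. N 0 \<omega> = 0) \<and>
     independent_increments M (\<lambda>t \<omega>. real (N t \<omega>)) \<and>
     (\<forall>s\<ge>0. \<forall>t>s. \<forall>k. measure M {\<omega> \<in> space M. N t \<omega> = N s \<omega> + k} =
                        pmf (poisson_pmf (rate * (t - s))) k) \<and>
     right_continuous_paths M N"

text \<open>
  \<open>Z t = X (T t)\<close> almost surely for each \<open>t \<ge> 0\<close>. The process \<open>Z\<close> is kept as a separate
  object because \<open>\<omega> \<mapsto> X (T t \<omega>) \<omega>\<close> may fail to be measurable on the null set where the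
  paths of \<open>X\<close> or \<open>T\<close> are irregular.
\<close>

definition time_change :: "'a measure \<Rightarrow> (real \<Rightarrow> 'a \<Rightarrow> nat) \<Rightarrow> (real \<Rightarrow> 'a \<Rightarrow> real)
    \<Rightarrow> (real \<Rightarrow> 'a \<Rightarrow> nat) \<Rightarrow> bool" where
  "time_change M X T Z \<longleftrightarrow>
     process M (count_space UNIV) Z \<and>
     (\<forall>t\<ge>0. AE \<omega> in M. Z t \<omega> = X (T t \<omega>) \<omega>)"

definition caputo :: "real \<Rightarrow> (real \<Rightarrow> real) \<Rightarrow> real \<Rightarrow> real" where
  "caputo \<beta> f t =
     1 / Gamma (1 - \<beta>) * (LINT s:{0<..<t}|lborel. deriv f s / (t - s) powr \<beta>)"

definition marginal :: "'a measure \<Rightarrow> (real \<Rightarrow> 'a \<Rightarrow> nat) \<Rightarrow> nat \<Rightarrow> real \<Rightarrow> real" where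
  "marginal M X n t = measure M {\<omega> \<in> space M. X t \<omega> = n}"

text \<open>
  The fractional Poisson process \<open>X\<close> on \<open>M\<close>. Its law is that of a Poisson process at an
  independent inverse stable subordinator; the latter two live on a probability space \<open>L\<close>
  which may differ from \<open>M\<close>. The differential equations are imposed for \<open>t > 0\<close> only, since
  at \<open>t = 0\<close> the Caputo integral is empty. Right-continuity of the paths is part of the
  notion because finite-dimensional distributions say nothing about the value of \<open>X\<close> at an
  independent random time with diffuse law: altering \<open>X\<close> at that time changes no
  finite-dimensional distribution.
\<close>

definition fractional_poisson_process ::
    "real \<Rightarrow> real \<Rightarrow> 'b measure \<Rightarrow> 'a measure \<Rightarrow> (real \<Rightarrow> 'a \<Rightarrow> nat) \<Rightarrow> bool" where
  "fractional_poisson_process \<beta> rate L M X \<longleftrightarrow>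
     (\<forall>n. marginal M X n 0 = (if n = 0 then 1 else 0)) \<and>
     (\<forall>t>0. caputo \<beta> (marginal M X 0) t = - rate * marginal M X 0 t) \<and>
     (\<forall>t>0. \<forall>n\<ge>1. caputo \<beta> (marginal M X n) t =
        - rate * marginal M X n t + rate * marginal M X (n - 1) t) \<and>
     (\<exists>N E W. poisson_process rate L N \<and>
        inverse_stable_subordinator \<beta> L E \<and>
        independent_processes L (\<lambda>t \<omega>. real (N t \<omega>)) E \<and>
        time_change L N E W \<and>
        same_fdd M X L W (count_space UNIV)) \<and>
     right_continuous_paths M X"

definition covariance :: "'a measure \<Rightarrow> ('a \<Rightarrow> real) \<Rightarrow> ('a \<Rightarrow> real) \<Rightarrow> real" where
  "covariance M U V =
     prob_space.expectation M (\<lambda>\<omega>. (U \<omega> - prob_space.expectation M U) *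
                                   (V \<omega> - prob_space.expectation M V))"

definition correlation :: "'a measure \<Rightarrow> ('a \<Rightarrow> real) \<Rightarrow> ('a \<Rightarrow> real) \<Rightarrow> real" where
  "correlation M U V =
     covariance M U V / sqrt (prob_space.variance M U * prob_space.variance M V)"

text \<open>
  Requiring \<open>c > 0\<close> rules out the default values of undefined correlations: if a variance is
  infinite or zero, then \<open>correlation\<close> is \<open>0\<close>.
\<close>

definition correlation_decay :: "'a measure \<Rightarrow> (real \<Rightarrow> 'a \<Rightarrow> real) \<Rightarrow> real \<Rightarrow> bool" where
  "correlation_decay M X d \<longleftrightarrow>
     d > 0 \<and>
     (\<forall>s>0. \<exists>c>0. ((\<lambda>t. correlation M (X s) (X t) / t powr (- d)) \<longlongrightarrow> c) at_top)"

definition long_range_dependent :: "'a measure \<Rightarrow> (real \<Rightarrow> 'a \<Rightarrow> real) \<Rightarrow> bool" where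
  "long_range_dependent M X \<longleftrightarrow> (\<exists>d. correlation_decay M X d \<and> d \<in> {0<..<1})"

end

theory Submission
  imports Defs
begin

text \<open>
  Let \<open>D\<close> be the stable subordinator, \<open>E\<close> its inverse, \<open>N\<close> the Poisson process, so that the fractional
  Poisson process has the law of \<open>N \<circ> E\<close>, and \<open>Q = N\<^sub>\<beta> \<circ> Y\<close>. The correlation of \<open>Q s\<close> and \<open>Q t\<close> decays
  like \<open>t powr (- \<beta>)\<close> for a simple reason: the covariance converges to a positive constant, while the
  standard deviation of \<open>Q t\<close> grows like \<open>t powr \<beta>\<close>. Only first and second moments matter, and they
  are followed through the two time changes.

  Up to the difference between strict and weak inequality, \<open>E t > r\<close> is the event \<open>D r \<le> t\<close>. Moments
  of \<open>E\<close> are therefore integrals of lower tails of \<open>D\<close>. A Laplace transform determines a law on the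
  half-line, hence \<open>D\<close> is self-similar, and this gives \<open>m1 t\<^sup>\<beta>\<close> and \<open>m2 t\<^sup>2\<^sup>\<beta>\<close> for the
  first two moments of \<open>E t\<close>. The joint moments are enclosed between bounds. For \<open>s < t\<close> the
  quantity \<open>\<E>[E s * E t] - \<E>[(E s)\<^sup>2] / 2\<close> is the integral over
  \<open>r, h > 0\<close> of the probability of \<open>D r \<le> s\<close> and \<open>D (r + h) \<le> t\<close>. Since \<open>0 \<le> D r \<le> s\<close> there,
  replacing the second event by a bound \<open>t - s\<close> or \<open>t\<close> on the increment \<open>D (r + h) - D r\<close> encloses
  this probability between two products, by independence of increments. Consequently
  \<open>\<E>[E s] \<E>[E (t - s)] \<le> \<E>[E s * E t] - \<E>[(E s)\<^sup>2] / 2 \<le> \<E>[E s] \<E>[E t]\<close>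
  (\<open>E_product_lower\<close>, \<open>E_product_upper\<close>).

  Conditioning on the random time (\<open>nn_integral_time_change\<close>) turns this into moment bounds for the
  fractional Poisson process (\<open>fractional_poisson_moments\<close>), with \<open>A = rate * m1\<close> and
  \<open>B = rate\<^sup>2 * m2\<close>, and then into bounds for \<open>Q\<close>. The gamma process has explicit power moments, and
  \<open>Y t - Y s\<close> is independent of \<open>Y s\<close>. With \<open>b\<^sup>\<beta> \<le> (b - a)\<^sup>\<beta> + a (b - a) powr (\<beta> - 1)\<close> all the
  error terms in the covariance carry the factor \<open>\<E>[Y (t - s) powr (\<beta> - 1)]\<close>, which tends to \<open>0\<close>.
  What remains is the constant \<open>A \<E>[Y s powr \<beta>] + B / 2 \<E>[Y s powr (2 * \<beta>)] > 0\<close>. The variance of \<open>Q t\<close>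
  divided by \<open>t powr (2 * \<beta>)\<close> tends to \<open>(B - A\<^sup>2) (p / \<alpha>) powr (2 * \<beta>)\<close>, and \<open>A\<^sup>2 < B\<close> expresses that \<open>E 1\<close>
  is not constant (\<open>E_not_constant\<close>).
\<close>

section \<open>Time change by an independent process\<close>

text \<open>
  A discretisation of mesh \<open>1 / Suc n\<close> that moves every \<open>r \<ge> 0\<close>
  strictly to the right, the side from which a right-continuous path is controlled. The truncation
  by \<open>nat\<close> keeps grid points in the index set \<open>{0..}\<close> for every
  \<open>r\<close>, also a negative one.
\<close>

definition right_grid :: "nat \<Rightarrow> real \<Rightarrow> real" where
  "right_grid n r = (real (nat \<lfloor>real (Suc n) * r\<rfloor>) + 1) / real (Suc n)"

lemma right_grid_nonneg: "0 \<le> right_grid n r"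
  by (simp add: right_grid_def)

lemma right_grid_bounds:
  assumes "0 \<le> r"
  shows "r < right_grid n r" "right_grid n r \<le> r + 1 / real (Suc n)"
proof -
  let ?k = "nat \<lfloor>real (Suc n) * r\<rfloor>"
  have "0 \<le> real (Suc n) * r"
    using assms by simp
  then have "real ?k \<le> real (Suc n) * r" "real (Suc n) * r < real ?k + 1"
    by linarith+
  then have "r < (real ?k + 1) / real (Suc n)" "real ?k / real (Suc n) \<le> r"
    by (simp_all only: pos_less_divide_eq pos_divide_le_eq of_nat_0_less_iff zero_less_Suc mult.commute)
  then show "r < right_grid n r" "right_grid n r \<le> r + 1 / real (Suc n)"
    unfolding right_grid_def add_divide_distrib by simp_all
qed

lemma filterlim_right_grid:
  assumes "0 \<le> r"
  shows "filterlim (\<lambda>n. right_grid n r) (at_right r) sequentially"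
proof -
  have "(\<lambda>n. right_grid n r) \<longlonglongrightarrow> r"
  proof (rule tendsto_sandwich[where f = "\<lambda>_. r" and h = "\<lambda>n. r + 1 / real (Suc n)"])
    show "(\<lambda>n. r + 1 / real (Suc n)) \<longlonglongrightarrow> r"
      using tendsto_add[OF tendsto_const LIMSEQ_inverse_real_of_nat, of r]
      by (simp add: inverse_eq_divide)
  qed (use right_grid_bounds[OF assms] in \<open>auto simp: less_imp_le simp del: of_nat_Suc\<close>)
  then show ?thesis
    using right_grid_bounds(1)[OF assms] by (simp add: filterlim_at less_imp_neq[THEN not_sym])
qed

text \<open>
  A right-continuous path with discrete values is constant immediately to the right of each point,
  so along the grid its value is eventually attained, not only approached.
\<close>

lemma right_continuous_eventually_grid:
  fixes x :: "real \<Rightarrow> nat"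
  assumes "continuous (at_right r) x" "0 \<le> r"
  shows "eventually (\<lambda>n. x (right_grid n r) = x r) sequentially"
proof -
  have "eventually (\<lambda>s. x s = x r) (at_right r)"
    using assms(1) by (simp add: continuous_within tendsto_discrete)
  with filterlim_right_grid[OF assms(2)] show ?thesis
    unfolding filterlim_iff by blast
qed

text \<open>
  Conditioning on the random time. A path evaluated at a random time is not a measurable function
  of a point of the uncountable product space, but its right-hand grid approximations are, as each
  takes only countably many time values. Their lower limit \<open>F\<close> is thus measurable on
  the product of the two path spaces and agrees with the evaluation on right-continuous paths.
  Independence says that the joint law of the paths is a product measure, and Fubini's theorem
  applied to \<open>F\<close> gives the claim.
\<close>

lemma nn_integral_time_change:
  fixes X :: "real \<Rightarrow> 'a \<Rightarrow> nat" and h :: "nat \<Rightarrow> nat \<Rightarrow> ennreal"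
  assumes M: "prob_space M"
    and indep: "independent_processes M (\<lambda>t \<omega>. real (X t \<omega>)) T"
    and rc: "right_continuous_paths M X"
    and tc: "time_change M X T Z"
    and T: "AE \<omega> in M. 0 \<le> T a \<omega>" "AE \<omega> in M. 0 \<le> T b \<omega>"
    and ab: "0 \<le> a" "0 \<le> b"
  shows "(\<integral>\<^sup>+\<omega>. h (Z a \<omega>) (Z b \<omega>) \<partial>M) =
         (\<integral>\<^sup>+\<omega>. (\<integral>\<^sup>+\<omega>'. h (X (T a \<omega>) \<omega>') (X (T b \<omega>) \<omega>') \<partial>M) \<partial>M)"
proof -
  interpret prob_space M by fact
  let ?S = "PiM {0::real..} (\<lambda>_. borel :: real measure)"
  let ?PX = "\<lambda>\<omega>. \<lambda>t\<in>{0..}. real (X t \<omega>)"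
  let ?PT = "\<lambda>\<omega>. \<lambda>t\<in>{0..}. T t \<omega>"
  define v where "v c n p = nat \<lfloor>fst p (right_grid n (snd p c))\<rfloor>"
    for c and n and p :: "(real \<Rightarrow> real) \<times> (real \<Rightarrow> real)"
  define F where "F p = liminf (\<lambda>n. h (v a n p) (v b n p))" for p
  have rv: "?PX \<in> measurable M ?S" "?PT \<in> measurable M ?S"
    and distr: "distr M ?S ?PX \<Otimes>\<^sub>M distr M ?S ?PT = distr M (?S \<Otimes>\<^sub>M ?S) (\<lambda>\<omega>. (?PX \<omega>, ?PT \<omega>))"
    using indep unfolding independent_processes_def indep_var_distribution_eq by auto
  have meas_v: "v c n \<in> measurable (?S \<Otimes>\<^sub>M ?S) (count_space UNIV)" if "0 \<le> c" for c n
  proof -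
    have "(\<lambda>p. nat \<lfloor>fst p ((real (nat \<lfloor>real (Suc n) * snd p c\<rfloor>) + 1) / real (Suc n))\<rfloor>) \<in> measurable (?S \<Otimes>\<^sub>M ?S) (count_space UNIV)"
    proof (rule measurable_compose_countable[where
          f = "\<lambda>k p. nat \<lfloor>fst p ((real k + 1) / real (Suc n))\<rfloor>"])
      fix k :: nat
      have [measurable]: "(\<lambda>x. x ((real k + 1) / real (Suc n))) \<in> borel_measurable ?S"
        by (rule measurable_component_singleton) auto
      show "(\<lambda>p. nat \<lfloor>fst p ((real k + 1) / real (Suc n))\<rfloor>)
              \<in> measurable (?S \<Otimes>\<^sub>M ?S) (count_space UNIV)"
        by measurable
    next
      have [measurable]: "(\<lambda>x. x c) \<in> borel_measurable ?S"
        by (rule measurable_component_singleton) (use that in auto)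
      show "(\<lambda>p. nat \<lfloor>real (Suc n) * snd p c\<rfloor>) \<in> measurable (?S \<Otimes>\<^sub>M ?S) (count_space UNIV)"
        by measurable
    qed
    then show ?thesis
      unfolding v_def right_grid_def .
  qed
  have meas_h: "(\<lambda>p. h (v a n p) (v b n p)) \<in> borel_measurable (?S \<Otimes>\<^sub>M ?S)" for n
    by (rule measurable_compose_countable[where f = "\<lambda>i p. h i (v b n p)", OF _ meas_v[OF ab(1)]],
        rule measurable_compose[OF meas_v[OF ab(2)]]) simp
  have meas_F: "F \<in> borel_measurable (?S \<Otimes>\<^sub>M ?S)"
    unfolding F_def by (rule borel_measurable_liminf) (rule meas_h)
  have F_eq: "F (?PX \<omega>', ?PT \<omega>) = h (X (T a \<omega>) \<omega>') (X (T b \<omega>) \<omega>')"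
    if cont: "\<forall>t\<ge>0. continuous (at_right t) (\<lambda>s. X s \<omega>')"
      and pos: "0 \<le> T a \<omega>" "0 \<le> T b \<omega>" for \<omega> \<omega>'
  proof -
    have "eventually (\<lambda>n. v c n (?PX \<omega>', ?PT \<omega>) = X (T c \<omega>) \<omega>') sequentially"
      if "0 \<le> c" "0 \<le> T c \<omega>" for c
      using right_continuous_eventually_grid[of "T c \<omega>" "\<lambda>s. X s \<omega>'"] cont that
      by (auto simp: v_def right_grid_nonneg elim: eventually_mono)
    from this[OF ab(1) pos(1)] this[OF ab(2) pos(2)]
    have "eventually (\<lambda>n. h (v a n (?PX \<omega>', ?PT \<omega>)) (v b n (?PX \<omega>', ?PT \<omega>)) =
            h (X (T a \<omega>) \<omega>') (X (T b \<omega>) \<omega>')) sequentially"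
      by eventually_elim simp
    then have "(\<lambda>n. h (v a n (?PX \<omega>', ?PT \<omega>)) (v b n (?PX \<omega>', ?PT \<omega>)))
        \<longlonglongrightarrow> h (X (T a \<omega>) \<omega>') (X (T b \<omega>) \<omega>')"
      by (rule tendsto_eventually)
    then show ?thesis
      unfolding F_def by (intro lim_imp_Liminf) auto
  qed
  have cont: "AE \<omega> in M. \<forall>t\<ge>0. continuous (at_right t) (\<lambda>s. X s \<omega>)"
    using rc by (simp add: right_continuous_paths_def)
  have Z: "AE \<omega> in M. Z a \<omega> = X (T a \<omega>) \<omega>" "AE \<omega> in M. Z b \<omega> = X (T b \<omega>) \<omega>"
    using tc ab by (auto simp: time_change_def)
  interpret DX: prob_space "distr M ?S ?PX" by (rule prob_space_distr) (rule rv)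
  interpret DT: prob_space "distr M ?S ?PT" by (rule prob_space_distr) (rule rv)
  interpret pair_sigma_finite "distr M ?S ?PX" "distr M ?S ?PT" ..
  have "(\<integral>\<^sup>+\<omega>. h (Z a \<omega>) (Z b \<omega>) \<partial>M) = (\<integral>\<^sup>+\<omega>. F (?PX \<omega>, ?PT \<omega>) \<partial>M)"
    by (rule nn_integral_cong_AE) (use cont Z T in \<open>eventually_elim, simp add: F_eq\<close>)
  also have "\<dots> = (\<integral>\<^sup>+p. F p \<partial>distr M (?S \<Otimes>\<^sub>M ?S) (\<lambda>\<omega>. (?PX \<omega>, ?PT \<omega>)))"
    by (rule nn_integral_distr[symmetric]) (use rv meas_F in auto)
  also have "\<dots> = (\<integral>\<^sup>+y. (\<integral>\<^sup>+x. F (x, y) \<partial>distr M ?S ?PX) \<partial>distr M ?S ?PT)"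
    unfolding distr[symmetric]
    by (rule nn_integral_snd[symmetric]) (use meas_F in simp)
  also have "\<dots> = (\<integral>\<^sup>+\<omega>. (\<integral>\<^sup>+x. F (x, ?PT \<omega>) \<partial>distr M ?S ?PX) \<partial>M)"
    by (rule nn_integral_distr[OF rv(2)]) (use meas_F in measurable)
  also have "\<dots> = (\<integral>\<^sup>+\<omega>. (\<integral>\<^sup>+\<omega>'. F (?PX \<omega>', ?PT \<omega>) \<partial>M) \<partial>M)"
  proof (rule nn_integral_cong)
    fix \<omega> assume "\<omega> \<in> space M"
    then have "?PT \<omega> \<in> space ?S"
      using rv(2) by (rule measurable_space[rotated])
    then show "(\<integral>\<^sup>+x. F (x, ?PT \<omega>) \<partial>distr M ?S ?PX) = (\<integral>\<^sup>+\<omega>'. F (?PX \<omega>', ?PT \<omega>) \<partial>M)"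
      using measurable_compose[OF measurable_Pair2' meas_F]
      by (intro nn_integral_distr[OF rv(1)]) simp
  qed
  also have "\<dots> = (\<integral>\<^sup>+\<omega>. (\<integral>\<^sup>+\<omega>'. h (X (T a \<omega>) \<omega>') (X (T b \<omega>) \<omega>') \<partial>M) \<partial>M)"
  proof (rule nn_integral_cong_AE, use T in eventually_elim)
    case (elim \<omega>)
    show ?case
      by (rule nn_integral_cong_AE, use cont in eventually_elim) (simp add: F_eq elim)
  qed
  finally show ?thesis .
qed

section \<open>Laplace transforms and laws on the half-line\<close>

text \<open>
  The moments of \<open>exp (- U)\<close> are the values of the Laplace transform of
  \<open>U\<close> at the naturals, so an approximating polynomial on \<open>{0..1}\<close> lets
  these values stand in for an arbitrary test function.
\<close>

lemma expectation_polynomial_approx: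
  fixes U :: "'a \<Rightarrow> real" and f :: "real \<Rightarrow> real"
  assumes M: "prob_space M" and U [measurable]: "U \<in> borel_measurable M"
    and nonneg: "AE \<omega> in M. 0 \<le> U \<omega>"
    and f [measurable]: "f \<in> borel_measurable borel" and bdd: "\<And>x. \<bar>f x\<bar> \<le> B"
    and approx: "\<And>x. x \<in> {0..1} \<Longrightarrow> \<bar>f x - (\<Sum>i\<le>n. a i * x ^ i)\<bar> \<le> e"
  shows "\<bar>(LINT \<omega>|M. f (exp (- U \<omega>))) - (\<Sum>i\<le>n. a i * (LINT \<omega>|M. exp (- real i * U \<omega>)))\<bar> \<le> e"
proof -
  interpret prob_space M by fact
  have int_exp: "integrable M (\<lambda>\<omega>. exp (- real i * U \<omega>))" for i
    by (rule integrable_const_bound[where B = 1]) (use nonneg in \<open>eventually_elim, simp\<close>, simp)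
  have int_f: "integrable M (\<lambda>\<omega>. f (exp (- U \<omega>)))"
    by (rule integrable_const_bound[where B = B]) (use bdd in auto)
  have pow: "exp (- real i * U \<omega>) = exp (- U \<omega>) ^ i" for i \<omega>
    by (simp add: exp_of_nat_mult[symmetric])
  have "(LINT \<omega>|M. f (exp (- U \<omega>))) - (\<Sum>i\<le>n. a i * (LINT \<omega>|M. exp (- real i * U \<omega>))) =
        (LINT \<omega>|M. f (exp (- U \<omega>)) - (\<Sum>i\<le>n. a i * exp (- real i * U \<omega>)))"
    using int_exp int_f by simp
  also have "\<bar>\<dots>\<bar> \<le> (LINT \<omega>|M. \<bar>f (exp (- U \<omega>)) - (\<Sum>i\<le>n. a i * exp (- real i * U \<omega>))\<bar>)"
    by (rule integral_abs_bound)
  also have "\<dots> \<le> (LINT \<omega>|M. e)"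
  proof (rule integral_mono_AE)
    show "AE \<omega> in M. \<bar>f (exp (- U \<omega>)) - (\<Sum>i\<le>n. a i * exp (- real i * U \<omega>))\<bar> \<le> e"
      using nonneg by eventually_elim (unfold pow, rule approx, simp)
  qed (use int_exp int_f in auto)
  also have "\<dots> = e"
    by (simp add: prob_space)
  finally show ?thesis .
qed

text \<open>
  Since \<open>exp (- U)\<close> lives in the compact interval \<open>{0..1}\<close>, the
  Weierstrass theorem extends agreement from polynomials to continuous test functions. The
  piecewise linear functions \<open>f n\<close> decrease to the indicator of \<open>{c..}\<close>
  with \<open>c = exp (- x)\<close>, that is, to the event \<open>U \<le> x\<close>.
\<close>

lemma laplace_transform_determines_cdf:
  fixes U :: "'a \<Rightarrow> real" and V :: "'b \<Rightarrow> real"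
  assumes M: "prob_space M" and U [measurable]: "U \<in> borel_measurable M"
    and U_nonneg: "AE \<omega> in M. 0 \<le> U \<omega>"
    and N: "prob_space N" and V [measurable]: "V \<in> borel_measurable N"
    and V_nonneg: "AE \<omega> in N. 0 \<le> V \<omega>"
    and eq: "\<And>n::nat. (LINT \<omega>|M. exp (- real n * U \<omega>)) = (LINT \<omega>|N. exp (- real n * V \<omega>))"
  shows "measure M {\<omega> \<in> space M. U \<omega> \<le> x} = measure N {\<omega> \<in> space N. V \<omega> \<le> x}"
proof -
  have test: "(LINT \<omega>|M. f (exp (- U \<omega>))) = (LINT \<omega>|N. f (exp (- V \<omega>)))"
    if cont: "continuous_on UNIV f" and bdd: "\<And>y. \<bar>f y\<bar> \<le> B" for f :: "real \<Rightarrow> real" and B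
  proof -
    have [measurable]: "f \<in> borel_measurable borel"
      using cont by (rule borel_measurable_continuous_onI)
    have "\<bar>(LINT \<omega>|M. f (exp (- U \<omega>))) - (LINT \<omega>|N. f (exp (- V \<omega>)))\<bar> \<le> e" if "0 < e" for e
    proof -
      obtain g where g: "real_polynomial_function g" "\<And>y. y \<in> {0..1} \<Longrightarrow> \<bar>f y - g y\<bar> < e / 2"
        using Stone_Weierstrass_real_polynomial_function[of "{0..1}" f "e / 2"] cont \<open>0 < e\<close>
        by (auto intro: continuous_on_subset)
      obtain a n where "g = (\<lambda>y. \<Sum>i\<le>n. a i * y ^ i)"
        using g(1) by (auto simp: real_polynomial_function_iff_sum)
      with g(2) have approx: "\<And>y. y \<in> {0..1} \<Longrightarrow> \<bar>f y - (\<Sum>i\<le>n. a i * y ^ i)\<bar> \<le> e / 2"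
        by (simp add: less_imp_le)
      have "\<bar>(LINT \<omega>|M. f (exp (- U \<omega>))) - (\<Sum>i\<le>n. a i * (LINT \<omega>|M. exp (- real i * U \<omega>)))\<bar> \<le> e / 2"
        by (rule expectation_polynomial_approx[OF M U U_nonneg _ bdd approx]) auto
      moreover have "\<bar>(LINT \<omega>|N. f (exp (- V \<omega>))) - (\<Sum>i\<le>n. a i * (LINT \<omega>|N. exp (- real i * V \<omega>)))\<bar> \<le> e / 2"
        by (rule expectation_polynomial_approx[OF N V V_nonneg _ bdd approx]) auto
      ultimately show ?thesis
        unfolding eq by linarith
    qed
    then show ?thesis
      using dense_eq0_I[of "(LINT \<omega>|M. f (exp (- U \<omega>))) - (LINT \<omega>|N. f (exp (- V \<omega>)))"] by simp
  qed
  define c where "c = exp (- x)"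
  define f where "f n y = min 1 (max 0 (1 + real n * (y - c)))" for n y
  have f_bdd: "\<bar>f n y\<bar> \<le> 1" for n y
    by (simp add: f_def)
  have f_cont: "continuous_on UNIV (f n)" for n
    unfolding f_def by (intro continuous_intros)
  have f_lim: "(\<lambda>n. f n y) \<longlonglongrightarrow> indicator {c..} y" for y
  proof (cases "c \<le> y")
    case True
    then show ?thesis by (simp add: f_def)
  next
    case False
    then obtain k :: nat where k: "1 < real k * (c - y)"
      using reals_Archimedean3[of "c - y"] by auto
    have "eventually (\<lambda>n. f n y = 0) sequentially"
    proof (rule eventually_sequentiallyI)
      fix n assume "k \<le> n"
      then have "real k * (c - y) \<le> real n * (c - y)"
        using False by (intro mult_right_mono) auto
      with k have "1 + real n * (y - c) \<le> 0"
        by (simp add: algebra_simps)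
      then show "f n y = 0"
        by (simp add: f_def)
    qed
    then show ?thesis
      using False by (simp add: tendsto_eventually)
  qed
  have lim: "(\<lambda>n. LINT \<omega>|P. f n (exp (- T \<omega>))) \<longlonglongrightarrow> measure P {\<omega> \<in> space P. T \<omega> \<le> x}"
    if P: "prob_space P" and [measurable]: "T \<in> borel_measurable P" for P :: "'c measure" and T
  proof -
    interpret prob_space P by fact
    have [measurable]: "f n \<in> borel_measurable borel" for n
      using f_cont by (rule borel_measurable_continuous_onI)
    have "(\<lambda>n. LINT \<omega>|P. f n (exp (- T \<omega>))) \<longlonglongrightarrow> (LINT \<omega>|P. indicator {c..} (exp (- T \<omega>)))"
      by (rule integral_dominated_convergence[where w = "\<lambda>_. 1"]) (use f_bdd f_lim in auto)
    also have "(LINT \<omega>|P. indicator {c..} (exp (- T \<omega>))) =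
        (LINT \<omega>|P. indicator {\<omega> \<in> space P. T \<omega> \<le> x} \<omega>)"
      by (rule Bochner_Integration.integral_cong) (auto simp: c_def indicator_def)
    finally show ?thesis
      by simp
  qed
  have "(\<lambda>n. LINT \<omega>|M. f n (exp (- U \<omega>))) = (\<lambda>n. LINT \<omega>|N. f n (exp (- V \<omega>)))"
    using test[OF f_cont f_bdd] by simp
  with lim[OF M U] lim[OF N V] show ?thesis
    by (auto intro: LIMSEQ_unique)
qed

section \<open>Independent increments and Poisson moments\<close>

text \<open>
  The case of two adjacent increments is all that second moments require; the time grid
  \<open>\<tau>\<close> is constant from index 2 onwards.
\<close>

lemma independent_increments_nn_integral:
  fixes f g :: "real \<Rightarrow> ennreal"
  assumes M: "prob_space M" and X: "independent_increments M X"
    and order: "0 \<le> u" "u < v" "v < w"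
    and [measurable]: "f \<in> borel_measurable borel" "g \<in> borel_measurable borel"
  shows "(\<integral>\<^sup>+\<omega>. f (X v \<omega> - X u \<omega>) * g (X w \<omega> - X v \<omega>) \<partial>M) =
         (\<integral>\<^sup>+\<omega>. f (X v \<omega> - X u \<omega>) \<partial>M) * (\<integral>\<^sup>+\<omega>. g (X w \<omega> - X v \<omega>) \<partial>M)"
proof -
  interpret prob_space M by fact
  define \<tau> where "\<tau> i = (if i = 0 then u else if i = 1 then v else w)" for i :: nat
  have "0 \<le> \<tau> 0" "\<forall>i<2. \<tau> i < \<tau> (Suc i)"
    using order by (auto simp: \<tau>_def less_2_cases_iff)
  then have "indep_vars (\<lambda>_. borel) (\<lambda>i \<omega>. X (\<tau> (Suc i)) \<omega> - X (\<tau> i) \<omega>) {..<2::nat}"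
    using X unfolding independent_increments_def by blast
  then have "indep_vars (\<lambda>_. borel)
      (\<lambda>i \<omega>. (if i = 0 then f else g) (X (\<tau> (Suc i)) \<omega> - X (\<tau> i) \<omega>)) {..<2::nat}"
    by (rule indep_vars_compose2) auto
  from indep_vars_nn_integral[OF _ this]
  show ?thesis
    by (simp add: numeral_2_eq_2 \<tau>_def lessThan_Suc mult.commute)
qed

text \<open>
  The first moment and the factorial moment \<open>k (k - 1)\<close> reduce to the exponential
  series by shifting the index once or twice.
\<close>

lemma poisson_pmf_sums:
  assumes "0 < \<mu>"
  shows "pmf (poisson_pmf \<mu>) sums 1"
    and "(\<lambda>k. real k * pmf (poisson_pmf \<mu>) k) sums \<mu>"
    and "(\<lambda>k. (real k)\<^sup>2 * pmf (poisson_pmf \<mu>) k) sums (\<mu> + \<mu>\<^sup>2)"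
proof -
  have p: "pmf (poisson_pmf \<mu>) k = \<mu> ^ k / fact k * exp (- \<mu>)" for k
    using assms by simp
  have base: "(\<lambda>k. \<mu> ^ k / fact k * exp (- \<mu>)) sums 1"
    using sums_mult2[OF exp_converges[of \<mu>], of "exp (- \<mu>)"]
    by (simp add: scaleR_conv_of_real divide_inverse mult.commute exp_minus)
  then show "pmf (poisson_pmf \<mu>) sums 1"
    unfolding p[symmetric] .
  have *: "real (Suc k) * pmf (poisson_pmf \<mu>) (Suc k) = \<mu> * (\<mu> ^ k / fact k * exp (- \<mu>))" for k
    unfolding p by (simp add: divide_simps)
  have "(\<lambda>k. real (Suc k) * pmf (poisson_pmf \<mu>) (Suc k)) sums (\<mu> - 0)"
    using sums_mult[OF base, of \<mu>] unfolding * by simp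
  then show first: "(\<lambda>k. real k * pmf (poisson_pmf \<mu>) k) sums \<mu>"
    by (subst (asm) sums_Suc_iff) simp
  have **: "real (Suc (Suc k)) * (real (Suc (Suc k)) - 1) * pmf (poisson_pmf \<mu>) (Suc (Suc k)) =
      \<mu>\<^sup>2 * (\<mu> ^ k / fact k * exp (- \<mu>))" for k
    unfolding p by (simp add: divide_simps power2_eq_square)
  have "(\<lambda>k. real (Suc (Suc k)) * (real (Suc (Suc k)) - 1) * pmf (poisson_pmf \<mu>) (Suc (Suc k)))
      sums (\<mu>\<^sup>2 - 0)"
    using sums_mult[OF base, of "\<mu>\<^sup>2"] unfolding ** by simp
  then have "(\<lambda>k. real (Suc k) * (real (Suc k) - 1) * pmf (poisson_pmf \<mu>) (Suc k)) sums (\<mu>\<^sup>2 - 0)"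
    by (subst (asm) sums_Suc_iff) simp
  then have "(\<lambda>k. real k * (real k - 1) * pmf (poisson_pmf \<mu>) k) sums \<mu>\<^sup>2"
    by (subst (asm) sums_Suc_iff) simp
  from sums_add[OF first this]
  show "(\<lambda>k. (real k)\<^sup>2 * pmf (poisson_pmf \<mu>) k) sums (\<mu> + \<mu>\<^sup>2)"
    by (simp add: algebra_simps power2_eq_square)
qed

context
  fixes L :: "'a measure" and N :: "real \<Rightarrow> 'a \<Rightarrow> nat" and rate :: real
  assumes L: "prob_space L" and N: "poisson_process rate L N" and rate: "0 < rate"
begin

interpretation prob_space L by (rule L)

lemma poisson_process_measurable:
  "0 \<le> t \<Longrightarrow> N t \<in> measurable L (count_space UNIV)"
  using N by (simp add: poisson_process_def process_def)

text \<open>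
  The increment probabilities are prescribed for upward jumps only. They sum to 1, so almost
  surely one of the events \<open>B k\<close> happens; this excludes downward jumps and allows
  integration over the partition.
\<close>

lemma poisson_increment:
  assumes st: "0 \<le> s" "s < t"
  shows "AE \<omega> in L. N s \<omega> \<le> N t \<omega>"
    and "(\<integral>\<^sup>+\<omega>. f (real (N t \<omega>) - real (N s \<omega>)) \<partial>L) =
         (\<Sum>k. f (real k) * ennreal (pmf (poisson_pmf (rate * (t - s))) k))"
proof -
  define B where "B k = {\<omega> \<in> space L. N t \<omega> = N s \<omega> + k}" for k
  have [measurable]: "N s \<in> measurable L (count_space UNIV)" "N t \<in> measurable L (count_space UNIV)"
    using st by (simp_all add: poisson_process_measurable)
  have B [measurable]: "B k \<in> sets L" for k
  proof -
    have "{\<omega> \<in> space L. real (N t \<omega>) = real (N s \<omega>) + real k} \<in> sets L"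
      by measurable
    also have "{\<omega> \<in> space L. real (N t \<omega>) = real (N s \<omega>) + real k} = B k"
      by (auto simp: B_def)
    finally show ?thesis .
  qed
  have prob_B: "prob (B k) = pmf (poisson_pmf (rate * (t - s))) k" for k
    using N st by (simp add: poisson_process_def B_def)
  have "disjoint_family B"
    by (auto simp: disjoint_family_on_def B_def)
  then have "(\<lambda>k. prob (B k)) sums prob (\<Union>k. B k)"
    by (intro finite_measure_UNION) auto
  moreover have "(\<lambda>k. prob (B k)) sums 1"
    unfolding prob_B using rate st by (intro poisson_pmf_sums(1)) simp
  ultimately have "prob (\<Union>k. B k) = 1"
    by (rule sums_unique2)
  then have ae: "AE \<omega> in L. \<omega> \<in> (\<Union>k. B k)"
    by (intro AE_prob_1)
  then show "AE \<omega> in L. N s \<omega> \<le> N t \<omega>"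
    by eventually_elim (auto simp: B_def)
  have "(\<integral>\<^sup>+\<omega>. f (real (N t \<omega>) - real (N s \<omega>)) \<partial>L) =
      (\<integral>\<^sup>+\<omega>. (\<Sum>k. f (real k) * indicator (B k) \<omega>) \<partial>L)"
  proof (rule nn_integral_cong_AE, use ae in eventually_elim)
    case (elim \<omega>)
    then obtain k where k: "\<omega> \<in> B k"
      by auto
    have "(\<lambda>j. f (real j) * indicator (B j) \<omega>) = (\<lambda>j. if j = k then f (real k) else 0)"
      using k by (auto simp: B_def fun_eq_iff indicator_def)
    moreover have "(\<lambda>j. if j = k then f (real k) else 0) sums f (real k)"
      by (rule sums_single)
    ultimately show ?case
      using k by (simp add: B_def sums_iff)
  qed
  also have "\<dots> = (\<Sum>k. f (real k) * emeasure L (B k))"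
    by (subst nn_integral_suminf) (auto simp: nn_integral_cmult)
  also have "\<dots> = (\<Sum>k. f (real k) * ennreal (pmf (poisson_pmf (rate * (t - s))) k))"
    by (simp add: emeasure_eq_measure prob_B)
  finally show "(\<integral>\<^sup>+\<omega>. f (real (N t \<omega>) - real (N s \<omega>)) \<partial>L) =
      (\<Sum>k. f (real k) * ennreal (pmf (poisson_pmf (rate * (t - s))) k))" .
qed

lemma poisson_increment_moments:
  assumes st: "0 \<le> s" "s < t"
  shows "(\<integral>\<^sup>+\<omega>. ennreal (real (N t \<omega>) - real (N s \<omega>)) \<partial>L) = ennreal (rate * (t - s))"
    and "(\<integral>\<^sup>+\<omega>. ennreal ((real (N t \<omega>) - real (N s \<omega>))\<^sup>2) \<partial>L) =
         ennreal (rate * (t - s) + (rate * (t - s))\<^sup>2)"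
proof -
  have pos: "0 < rate * (t - s)"
    using rate st by simp
  note sums = poisson_pmf_sums[OF pos]
  let ?p = "pmf (poisson_pmf (rate * (t - s)))"
  have "(\<integral>\<^sup>+\<omega>. ennreal (real (N t \<omega>) - real (N s \<omega>)) \<partial>L) = (\<Sum>k. ennreal (real k * ?p k))"
    unfolding poisson_increment(2)[OF st, of ennreal]
    by (rule suminf_cong) (rule ennreal_mult''[symmetric], rule pmf_nonneg)
  also have "\<dots> = ennreal (rate * (t - s))"
    by (rule suminf_ennreal_eq[OF _ sums(2)]) (rule mult_nonneg_nonneg, rule of_nat_0_le_iff, rule pmf_nonneg)
  finally show "(\<integral>\<^sup>+\<omega>. ennreal (real (N t \<omega>) - real (N s \<omega>)) \<partial>L) = ennreal (rate * (t - s))" .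
  have "(\<integral>\<^sup>+\<omega>. ennreal ((real (N t \<omega>) - real (N s \<omega>))\<^sup>2) \<partial>L) = (\<Sum>k. ennreal ((real k)\<^sup>2 * ?p k))"
    unfolding poisson_increment(2)[OF st, of "\<lambda>x. ennreal (x\<^sup>2)"]
    by (rule suminf_cong) (rule ennreal_mult''[symmetric], rule pmf_nonneg)
  also have "\<dots> = ennreal (rate * (t - s) + (rate * (t - s))\<^sup>2)"
    by (rule suminf_ennreal_eq[OF _ sums(3)]) (rule mult_nonneg_nonneg, rule zero_le_power2, rule pmf_nonneg)
  finally show "(\<integral>\<^sup>+\<omega>. ennreal ((real (N t \<omega>) - real (N s \<omega>))\<^sup>2) \<partial>L) =
      ennreal (rate * (t - s) + (rate * (t - s))\<^sup>2)" .
qed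

lemma poisson_start: "AE \<omega> in L. N 0 \<omega> = 0"
  using N by (simp add: poisson_process_def)

lemma poisson_mean:
  assumes "0 \<le> t"
  shows "(\<integral>\<^sup>+\<omega>. ennreal (real (N t \<omega>)) \<partial>L) = ennreal (rate * t)"
proof (cases "t = 0")
  case True
  have "(\<integral>\<^sup>+\<omega>. ennreal (real (N 0 \<omega>)) \<partial>L) = (\<integral>\<^sup>+\<omega>. 0 \<partial>L)"
    by (rule nn_integral_cong_AE) (use poisson_start in \<open>eventually_elim, simp\<close>)
  with True show ?thesis by simp
next
  case False
  have "(\<integral>\<^sup>+\<omega>. ennreal (real (N t \<omega>)) \<partial>L) = (\<integral>\<^sup>+\<omega>. ennreal (real (N t \<omega>) - real (N 0 \<omega>)) \<partial>L)"
    by (rule nn_integral_cong_AE) (use poisson_start in \<open>eventually_elim, simp\<close>)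
  with False assms show ?thesis
    by (simp add: poisson_increment_moments)
qed

lemma poisson_second_moment:
  assumes "0 \<le> t"
  shows "(\<integral>\<^sup>+\<omega>. ennreal ((real (N t \<omega>))\<^sup>2) \<partial>L) = ennreal (rate * t + (rate * t)\<^sup>2)"
proof (cases "t = 0")
  case True
  have "(\<integral>\<^sup>+\<omega>. ennreal ((real (N 0 \<omega>))\<^sup>2) \<partial>L) = (\<integral>\<^sup>+\<omega>. 0 \<partial>L)"
    by (rule nn_integral_cong_AE) (use poisson_start in \<open>eventually_elim, simp\<close>)
  with True show ?thesis by simp
next
  case False
  have "(\<integral>\<^sup>+\<omega>. ennreal ((real (N t \<omega>))\<^sup>2) \<partial>L) =
      (\<integral>\<^sup>+\<omega>. ennreal ((real (N t \<omega>) - real (N 0 \<omega>))\<^sup>2) \<partial>L)"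
    by (rule nn_integral_cong_AE) (use poisson_start in \<open>eventually_elim, simp\<close>)
  with False assms show ?thesis
    by (simp add: poisson_increment_moments)
qed

text \<open>
  For \<open>a < b\<close> the value at \<open>b\<close> is the value at \<open>a\<close> plus an
  independent increment.
\<close>

lemma poisson_product_moment:
  assumes ab: "0 \<le> a" "a \<le> b"
  shows "(\<integral>\<^sup>+\<omega>. ennreal (real (N a \<omega>) * real (N b \<omega>)) \<partial>L) = ennreal (rate * a + rate\<^sup>2 * a * b)"
proof -
  consider "a = b" | "a = 0" | "0 < a" "a < b"
    using ab by linarith
  then show ?thesis
  proof cases
    case 1
    then show ?thesis
      using poisson_second_moment[of a] ab by (simp add: power2_eq_square mult_ac)
  next
    case 2
    have "(\<integral>\<^sup>+\<omega>. ennreal (real (N 0 \<omega>) * real (N b \<omega>)) \<partial>L) = (\<integral>\<^sup>+\<omega>. 0 \<partial>L)"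
      by (rule nn_integral_cong_AE) (use poisson_start in \<open>eventually_elim, simp\<close>)
    with 2 show ?thesis by simp
  next
    case 3
    have [measurable]: "N a \<in> measurable L (count_space UNIV)" "N b \<in> measurable L (count_space UNIV)"
      "N 0 \<in> measurable L (count_space UNIV)"
      using 3 by (simp_all add: poisson_process_measurable)
    have le: "AE \<omega> in L. N a \<omega> \<le> N b \<omega>"
      using poisson_increment(1)[of a b] 3 by simp
    have "(\<integral>\<^sup>+\<omega>. ennreal (real (N a \<omega>) * real (N b \<omega>)) \<partial>L) =
        (\<integral>\<^sup>+\<omega>. ennreal ((real (N a \<omega>))\<^sup>2) +
          ennreal (real (N a \<omega>) - real (N 0 \<omega>)) * ennreal (real (N b \<omega>) - real (N a \<omega>)) \<partial>L)"
    proof (rule nn_integral_cong_AE, use le poisson_start in eventually_elim)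
      case (elim \<omega>)
      have "real (N a \<omega>) * real (N b \<omega>) =
          (real (N a \<omega>))\<^sup>2 + (real (N a \<omega>) - real (N 0 \<omega>)) * (real (N b \<omega>) - real (N a \<omega>))"
        using elim by (simp add: power2_eq_square algebra_simps)
      then show ?case
        using elim by (simp add: ennreal_mult''[symmetric])
    qed
    also have "\<dots> = (\<integral>\<^sup>+\<omega>. ennreal ((real (N a \<omega>))\<^sup>2) \<partial>L) +
        (\<integral>\<^sup>+\<omega>. ennreal (real (N a \<omega>) - real (N 0 \<omega>)) * ennreal (real (N b \<omega>) - real (N a \<omega>)) \<partial>L)"
      by (rule nn_integral_add) measurable
    also have "(\<integral>\<^sup>+\<omega>. ennreal (real (N a \<omega>) - real (N 0 \<omega>)) * ennreal (real (N b \<omega>) - real (N a \<omega>)) \<partial>L) =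
        ennreal (rate * a) * ennreal (rate * (b - a))"
      using independent_increments_nn_integral[OF L, of "\<lambda>t \<omega>. real (N t \<omega>)" 0 a b ennreal ennreal]
        N 3 poisson_increment_moments(1)[of 0 a] poisson_increment_moments(1)[of a b]
      by (simp add: poisson_process_def)
    finally show ?thesis
      using 3 rate poisson_second_moment[of a]
      by (simp add: ennreal_mult[symmetric] ennreal_plus[symmetric] power2_eq_square algebra_simps
          del: ennreal_plus)
  qed
qed

end

section \<open>Moments as integrals of tails\<close>

text \<open>
  The layer-cake formula. Strict and weak tails differ in at most countably many \<open>r\<close>
  and have the same integral; both are needed because the lower tails of a process lie between the
  strict and the weak upper tails of its inverse. The relation \<open>R\<close> treats the two at
  once.
\<close>

lemma
  fixes U :: "'a \<Rightarrow> real"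
  assumes M: "prob_space M" and U [measurable]: "U \<in> borel_measurable M"
    and R: "R = (<) \<or> R = (\<le>)"
  shows measurable_tail: "(\<lambda>r. emeasure M {\<omega> \<in> space M. R r (U \<omega>)}) \<in> borel_measurable borel"
    and nn_integral_tail:
      "(\<integral>\<^sup>+r. emeasure M {\<omega> \<in> space M. R r (U \<omega>)} * indicator {0<..} r \<partial>lborel) =
       (\<integral>\<^sup>+\<omega>. ennreal (U \<omega>) \<partial>M)"
proof -
  interpret prob_space M by fact
  note integral_measurable = borel_measurable_nn_integral_fst
  interpret pair_sigma_finite lborel M ..
  have R_meas: "Measurable.pred (borel \<Otimes>\<^sub>M M) (\<lambda>p. R (fst p) (U (snd p)))"
    using R by (elim disjE) (simp_all, measurable)
  define \<phi> :: "real \<Rightarrow> 'a \<Rightarrow> ennreal" where "\<phi> r \<omega> = (if R r (U \<omega>) then 1 else 0)" for r \<omega>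
  have \<phi>: "(\<lambda>p. \<phi> (fst p) (snd p)) \<in> borel_measurable (borel \<Otimes>\<^sub>M M)"
    unfolding \<phi>_def using R_meas by measurable
  have emeasure_eq: "emeasure M {\<omega> \<in> space M. R r (U \<omega>)} = (\<integral>\<^sup>+\<omega>. \<phi> r \<omega> \<partial>M)" for r
  proof -
    have "{\<omega> \<in> space M. R r (U \<omega>)} \<in> sets M"
      using R by (elim disjE) (simp_all, measurable)
    then have "emeasure M {\<omega> \<in> space M. R r (U \<omega>)} = (\<integral>\<^sup>+\<omega>. indicator {\<omega> \<in> space M. R r (U \<omega>)} \<omega> \<partial>M)"
      by simp
    also have "\<dots> = (\<integral>\<^sup>+\<omega>. \<phi> r \<omega> \<partial>M)"
      by (rule nn_integral_cong) (auto simp: \<phi>_def)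
    finally show ?thesis .
  qed
  show "(\<lambda>r. emeasure M {\<omega> \<in> space M. R r (U \<omega>)}) \<in> borel_measurable borel"
    unfolding emeasure_eq using integral_measurable[OF \<phi>] by simp
  have "(\<integral>\<^sup>+r. emeasure M {\<omega> \<in> space M. R r (U \<omega>)} * indicator {0<..} r \<partial>lborel) =
      (\<integral>\<^sup>+r. (\<integral>\<^sup>+\<omega>. \<phi> r \<omega> * indicator {0<..} r \<partial>M) \<partial>lborel)"
    unfolding emeasure_eq
    using measurable_compose[OF measurable_Pair1' \<phi>]
    by (intro nn_integral_cong nn_integral_multc[symmetric]) (simp add: comp_def)
  also have "\<dots> = (\<integral>\<^sup>+\<omega>. (\<integral>\<^sup>+r. \<phi> r \<omega> * indicator {0<..} r \<partial>lborel) \<partial>M)"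
    by (rule Fubini'[symmetric]) (use \<phi> in \<open>simp add: case_prod_beta'\<close>)
  also have "\<dots> = (\<integral>\<^sup>+\<omega>. ennreal (U \<omega>) \<partial>M)"
  proof (rule nn_integral_cong)
    fix \<omega>
    have "(\<lambda>r. \<phi> r \<omega> * indicator {0<..} r) = indicator (if R = (<) then {0<..<U \<omega>} else {0<..U \<omega>})"
      using R by (auto simp: \<phi>_def fun_eq_iff split: split_indicator)
    then show "(\<integral>\<^sup>+r. \<phi> r \<omega> * indicator {0<..} r \<partial>lborel) = ennreal (U \<omega>)"
      by (cases "0 \<le> U \<omega>") (auto simp: ennreal_neg)
  qed
  finally show "(\<integral>\<^sup>+r. emeasure M {\<omega> \<in> space M. R r (U \<omega>)} * indicator {0<..} r \<partial>lborel) =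
       (\<integral>\<^sup>+\<omega>. ennreal (U \<omega>) \<partial>M)" .
qed

lemma nn_integral_linear_ramp:
  assumes "0 \<le> u" "u \<le> (v::real)" and R: "R = (<) \<or> R = (\<le>)"
  shows "(\<integral>\<^sup>+r. (if 0 < r \<and> R r u then ennreal (v - r) else 0) \<partial>lborel) = ennreal (u * v - u\<^sup>2 / 2)"
proof -
  have "(\<integral>\<^sup>+r. (if 0 < r \<and> R r u then ennreal (v - r) else 0) \<partial>lborel) =
      (\<integral>\<^sup>+r. ennreal (v - r) * indicator {0..u} r \<partial>lborel)"
    by (rule nn_integral_cong_AE, use AE_lborel_singleton[of 0] AE_lborel_singleton[of u] in eventually_elim)
       (use R in \<open>auto split: split_indicator\<close>)
  also have "\<dots> = ennreal ((v * u - u\<^sup>2 / 2) - (v * 0 - 0\<^sup>2 / 2))"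
    by (rule nn_integral_FTC_Icc[where F = "\<lambda>r. v * r - r\<^sup>2 / 2"])
       (use assms in \<open>auto intro!: derivative_eq_intros\<close>)
  finally show ?thesis
    by (simp add: mult.commute)
qed

text \<open>
  Integrating the event \<open>r < U\<close>, \<open>r + h < V\<close> over \<open>r\<close> and
  \<open>h\<close> gives the area of the part of the rectangle \<open>[0, U] \<times> [0,
  V]\<close> above the diagonal, which is \<open>U V - U\<^sup>2 / 2\<close>.
\<close>

lemma nn_integral_joint_tail:
  fixes U V :: "'a \<Rightarrow> real"
  assumes M: "prob_space M"
    and U [measurable]: "U \<in> borel_measurable M" and V [measurable]: "V \<in> borel_measurable M"
    and order: "AE \<omega> in M. 0 \<le> U \<omega> \<and> U \<omega> \<le> V \<omega>"
    and R: "R = (<) \<or> R = (\<le>)"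
  shows "(\<integral>\<^sup>+r. (\<integral>\<^sup>+h. emeasure M {\<omega> \<in> space M. R r (U \<omega>) \<and> R (r + h) (V \<omega>)} * indicator {0<..} h \<partial>lborel)
            * indicator {0<..} r \<partial>lborel) =
         (\<integral>\<^sup>+\<omega>. ennreal (U \<omega> * V \<omega> - (U \<omega>)\<^sup>2 / 2) \<partial>M)"
proof -
  interpret prob_space M by fact
  interpret pair_sigma_finite lborel M ..
  have inner: "(\<integral>\<^sup>+h. emeasure M {\<omega> \<in> space M. R r (U \<omega>) \<and> R (r + h) (V \<omega>)} * indicator {0<..} h \<partial>lborel) =
      (\<integral>\<^sup>+\<omega>. (if R r (U \<omega>) then ennreal (V \<omega> - r) else 0) \<partial>M)" for r
  proof -
    define \<phi> :: "real \<Rightarrow> 'a \<Rightarrow> ennreal"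
      where "\<phi> h \<omega> = (if 0 < h \<and> R r (U \<omega>) \<and> R (r + h) (V \<omega>) then 1 else 0)" for h \<omega>
    have R_meas: "Measurable.pred (borel \<Otimes>\<^sub>M M)
        (\<lambda>p. 0 < fst p \<and> R r (U (snd p)) \<and> R (r + fst p) (V (snd p)))"
      using R by (elim disjE) (simp_all, measurable)
    have \<phi>: "(\<lambda>p. \<phi> (fst p) (snd p)) \<in> borel_measurable (borel \<Otimes>\<^sub>M M)"
      unfolding \<phi>_def using R_meas by measurable
    have "emeasure M {\<omega> \<in> space M. R r (U \<omega>) \<and> R (r + h) (V \<omega>)} * indicator {0<..} h =
        (\<integral>\<^sup>+\<omega>. \<phi> h \<omega> \<partial>M)" for h
    proof -
      have [measurable]: "{\<omega> \<in> space M. R r (U \<omega>) \<and> R (r + h) (V \<omega>)} \<in> sets M"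
        using R by (elim disjE) (simp_all, measurable)
      have "emeasure M {\<omega> \<in> space M. R r (U \<omega>) \<and> R (r + h) (V \<omega>)} * indicator {0<..} h =
          (\<integral>\<^sup>+\<omega>. indicator {\<omega> \<in> space M. R r (U \<omega>) \<and> R (r + h) (V \<omega>)} \<omega> * indicator {0<..} h \<partial>M)"
        by (simp add: nn_integral_multc)
      also have "\<dots> = (\<integral>\<^sup>+\<omega>. \<phi> h \<omega> \<partial>M)"
        by (rule nn_integral_cong) (auto simp: \<phi>_def split: split_indicator)
      finally show ?thesis .
    qed
    then have "(\<integral>\<^sup>+h. emeasure M {\<omega> \<in> space M. R r (U \<omega>) \<and> R (r + h) (V \<omega>)} * indicator {0<..} h \<partial>lborel) =
        (\<integral>\<^sup>+h. (\<integral>\<^sup>+\<omega>. \<phi> h \<omega> \<partial>M) \<partial>lborel)"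
      by simp
    also have "\<dots> = (\<integral>\<^sup>+\<omega>. (\<integral>\<^sup>+h. \<phi> h \<omega> \<partial>lborel) \<partial>M)"
      by (rule Fubini'[symmetric]) (use \<phi> in \<open>simp add: case_prod_beta'\<close>)
    also have "\<dots> = (\<integral>\<^sup>+\<omega>. (if R r (U \<omega>) then ennreal (V \<omega> - r) else 0) \<partial>M)"
    proof (rule nn_integral_cong)
      fix \<omega>
      have "(\<lambda>h. \<phi> h \<omega>) = indicator (if R r (U \<omega>) then if R = (<) then {0<..<V \<omega> - r} else {0<..V \<omega> - r} else {})"
        using R by (auto simp: \<phi>_def fun_eq_iff split: split_indicator)
      then show "(\<integral>\<^sup>+h. \<phi> h \<omega> \<partial>lborel) = (if R r (U \<omega>) then ennreal (V \<omega> - r) else 0)"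
        by (cases "0 \<le> V \<omega> - r") (auto simp: ennreal_neg)
    qed
    finally show ?thesis .
  qed
  define \<psi> where "\<psi> r \<omega> = (if 0 < r \<and> R r (U \<omega>) then ennreal (V \<omega> - r) else 0)" for r \<omega>
  have R_meas: "Measurable.pred (borel \<Otimes>\<^sub>M M) (\<lambda>p. 0 < fst p \<and> R (fst p) (U (snd p)))"
    using R by (elim disjE) (simp_all, measurable)
  have \<psi>: "(\<lambda>p. \<psi> (fst p) (snd p)) \<in> borel_measurable (borel \<Otimes>\<^sub>M M)"
    unfolding \<psi>_def using R_meas by measurable
  have "(\<integral>\<^sup>+r. (\<integral>\<^sup>+\<omega>. (if R r (U \<omega>) then ennreal (V \<omega> - r) else 0) \<partial>M) * indicator {0<..} r \<partial>lborel) =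
      (\<integral>\<^sup>+r. (\<integral>\<^sup>+\<omega>. \<psi> r \<omega> \<partial>M) \<partial>lborel)"
    by (rule nn_integral_cong) (auto simp: \<psi>_def split: split_indicator)
  also have "\<dots> = (\<integral>\<^sup>+\<omega>. (\<integral>\<^sup>+r. \<psi> r \<omega> \<partial>lborel) \<partial>M)"
    by (rule Fubini'[symmetric]) (use \<psi> in \<open>simp add: case_prod_beta'\<close>)
  also have "\<dots> = (\<integral>\<^sup>+\<omega>. ennreal (U \<omega> * V \<omega> - (U \<omega>)\<^sup>2 / 2) \<partial>M)"
    by (rule nn_integral_cong_AE, use order in eventually_elim)
       (simp add: \<psi>_def nn_integral_linear_ramp[OF _ _ R])
  finally show ?thesis
    unfolding inner .
qed

text \<open>
  Comparing a strict tail with a weak one suffices, since both have the same integral.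
\<close>

lemma nn_integral_tail_mono:
  fixes U :: "'a \<Rightarrow> real" and V :: "'b \<Rightarrow> real"
  assumes "prob_space M" "U \<in> borel_measurable M" "prob_space N" "V \<in> borel_measurable N"
    and "\<And>r. 0 < r \<Longrightarrow> emeasure M {\<omega> \<in> space M. r < U \<omega>} \<le> emeasure N {\<omega> \<in> space N. r \<le> V \<omega>}"
  shows "(\<integral>\<^sup>+\<omega>. ennreal (U \<omega>) \<partial>M) \<le> (\<integral>\<^sup>+\<omega>. ennreal (V \<omega>) \<partial>N)"
proof -
  have "(\<integral>\<^sup>+r. emeasure M {\<omega> \<in> space M. r < U \<omega>} * indicator {0<..} r \<partial>lborel) \<le>
      (\<integral>\<^sup>+r. emeasure N {\<omega> \<in> space N. r \<le> V \<omega>} * indicator {0<..} r \<partial>lborel)"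
    using assms(5) by (intro nn_integral_mono) (auto split: split_indicator)
  then show ?thesis
    using nn_integral_tail[of M U "(<)"] nn_integral_tail[of N V "(\<le>)"] assms by simp
qed

lemma nn_integral_product_tails:
  fixes U V :: "'a \<Rightarrow> real"
  assumes "prob_space M" "U \<in> borel_measurable M" "V \<in> borel_measurable M"
    and R: "R = (<) \<or> R = (\<le>)"
  shows "(\<integral>\<^sup>+\<omega>. ennreal (U \<omega>) \<partial>M) * (\<integral>\<^sup>+\<omega>. ennreal (V \<omega>) \<partial>M) =
    (\<integral>\<^sup>+r. (\<integral>\<^sup>+h. emeasure M {\<omega> \<in> space M. R r (U \<omega>)} * emeasure M {\<omega> \<in> space M. R h (V \<omega>)}
       * indicator {0<..} h \<partial>lborel) * indicator {0<..} r \<partial>lborel)"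
proof -
  note [measurable] = measurable_tail[OF assms(1,2) R] measurable_tail[OF assms(1,3) R]
  have "(\<integral>\<^sup>+h. emeasure M {\<omega> \<in> space M. R r (U \<omega>)} * emeasure M {\<omega> \<in> space M. R h (V \<omega>)}
       * indicator {0<..} h \<partial>lborel) = emeasure M {\<omega> \<in> space M. R r (U \<omega>)} * (\<integral>\<^sup>+\<omega>. ennreal (V \<omega>) \<partial>M)" for r
    unfolding nn_integral_tail[OF assms(1,3) R, symmetric] mult.assoc
    by (rule nn_integral_cmult) measurable
  then have "(\<integral>\<^sup>+r. (\<integral>\<^sup>+h. emeasure M {\<omega> \<in> space M. R r (U \<omega>)} * emeasure M {\<omega> \<in> space M. R h (V \<omega>)}
       * indicator {0<..} h \<partial>lborel) * indicator {0<..} r \<partial>lborel) =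
      (\<integral>\<^sup>+r. (emeasure M {\<omega> \<in> space M. R r (U \<omega>)} * indicator {0<..} r) *
        (\<integral>\<^sup>+\<omega>. ennreal (V \<omega>) \<partial>M) \<partial>lborel)"
    by (simp only: mult_ac)
  also have "\<dots> = (\<integral>\<^sup>+\<omega>. ennreal (U \<omega>) \<partial>M) * (\<integral>\<^sup>+\<omega>. ennreal (V \<omega>) \<partial>M)"
    unfolding nn_integral_tail[OF assms(1,2) R, symmetric] by (rule nn_integral_multc) measurable
  finally show ?thesis ..
qed

section \<open>The inverse stable subordinator\<close>

text \<open>
  A stable subordinator \<open>D\<close> together with its inverse \<open>E\<close>, both on the
  probability space \<open>L\<close>.
\<close>

locale stable_inverse = prob_space L for L :: "'a measure" +
  fixes \<beta> :: real and D E :: "real \<Rightarrow> 'a \<Rightarrow> real"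
  assumes \<beta>: "0 < \<beta>" "\<beta> < 1"
    and D: "stable_subordinator \<beta> L D"
    and E_process: "process L borel E"
    and E_inverse: "AE \<omega> in L. \<forall>t\<ge>0. E t \<omega> = Inf {r. 0 \<le> r \<and> D r \<omega> > t}"
begin

lemma D_subordinator: "subordinator L D"
  using D by (simp add: stable_subordinator_def)

lemma D_measurable: "0 \<le> r \<Longrightarrow> D r \<in> borel_measurable L"
  using D_subordinator by (simp add: subordinator_def process_def)

lemma E_measurable: "0 \<le> t \<Longrightarrow> E t \<in> borel_measurable L"
  using E_process by (simp add: process_def)

lemma D_laplace:
  assumes "0 \<le> r" "0 \<le> u"
  shows "(LINT \<omega>|L. exp (- u * D r \<omega>)) = exp (- r * u powr \<beta>)"
  using D assms by (simp add: stable_subordinator_def)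

lemma D_mono_nonneg: "AE \<omega> in L. mono_on {0..} (\<lambda>r. D r \<omega>) \<and> (\<forall>r\<ge>0. 0 \<le> D r \<omega>)"
proof -
  have "AE \<omega> in L. mono_on {0..} (\<lambda>r. D r \<omega>)" "AE \<omega> in L. D 0 \<omega> = 0"
    using D_subordinator by (simp_all add: subordinator_def)
  then show ?thesis
  proof eventually_elim
    case (elim \<omega>)
    then show ?case
      using mono_onD[OF elim(1), of 0] by auto
  qed
qed

lemma D_nonneg: "0 \<le> r \<Longrightarrow> AE \<omega> in L. 0 \<le> D r \<omega>"
  using D_mono_nonneg by eventually_elim auto

lemma integrable_exp_D:
  assumes "0 \<le> r" "0 \<le> u"
  shows "integrable L (\<lambda>\<omega>. exp (- u * D r \<omega>))"
proof (rule integrable_const_bound[where B = 1])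
  show "AE \<omega> in L. norm (exp (- u * D r \<omega>)) \<le> 1"
    using D_nonneg[OF assms(1)] by eventually_elim (use assms in simp)
qed (use D_measurable[OF assms(1)] in simp)

text \<open>
  Markov's inequality for \<open>exp (- D r)\<close>.
\<close>

lemma D_lower_tail:
  assumes "0 \<le> r"
  shows "prob {\<omega> \<in> space L. D r \<omega> \<le> t} \<le> exp (t - r)"
proof -
  note [measurable] = D_measurable[OF assms]
  have "prob {\<omega> \<in> space L. D r \<omega> \<le> t} = (LINT \<omega>|L. indicator {\<omega> \<in> space L. D r \<omega> \<le> t} \<omega>)"
    by simp
  also have "\<dots> \<le> (LINT \<omega>|L. exp t * exp (- 1 * D r \<omega>))"
  proof (rule integral_mono)
    show "integrable L (\<lambda>\<omega>. exp t * exp (- 1 * D r \<omega>))"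
      using integrable_exp_D[OF assms, of 1] by simp
    show "indicator {\<omega> \<in> space L. D r \<omega> \<le> t} \<omega> \<le> exp t * exp (- 1 * D r \<omega>)" for \<omega>
      by (auto simp: indicator_def exp_add[symmetric])
  qed (auto simp: emeasure_eq_measure)
  also have "\<dots> = exp t * exp (- r)"
    using D_laplace[OF assms, of 1] by simp
  finally show ?thesis
    by (simp add: exp_add[symmetric])
qed

text \<open>
  Unbounded paths make the set in the definition of \<open>E t\<close> nonempty, so that its
  infimum is meaningful.
\<close>

lemma D_unbounded: "AE \<omega> in L. \<forall>t. \<exists>r\<ge>0. D r \<omega> > t"
proof -
  have "AE \<omega> in L. \<exists>n::nat. D (real n) \<omega> > real m" for m :: nat
  proof -
    let ?A = "\<lambda>n::nat. {\<omega> \<in> space L. D (real n) \<omega> \<le> real m}"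
    have [measurable]: "D (real n) \<in> borel_measurable L" for n
      by (simp add: D_measurable)
    have A [measurable]: "(\<Inter>n. ?A n) \<in> sets L"
      by (intro sets.countable_INT) auto
    have "prob (\<Inter>n. ?A n) \<le> exp (real m - real n)" for n
    proof -
      have "prob (\<Inter>n. ?A n) \<le> prob (?A n)"
        by (rule finite_measure_mono) auto
      also have "\<dots> \<le> exp (real m - real n)"
        by (rule D_lower_tail) simp
      finally show ?thesis .
    qed
    moreover have "(\<lambda>n. exp (real m - real n)) \<longlonglongrightarrow> 0"
      by real_asymp
    ultimately have "prob (\<Inter>n. ?A n) \<le> 0"
      by (intro LIMSEQ_le_const) auto
    then have "AE \<omega> in L. \<omega> \<notin> (\<Inter>n. ?A n)"
      by (intro AE_not_in) (simp add: null_sets_def emeasure_eq_measure measure_le_0_iff)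
    then show ?thesis
      using AE_space by eventually_elim (auto simp: not_le)
  qed
  then have "AE \<omega> in L. \<forall>m::nat. \<exists>n::nat. D (real n) \<omega> > real m"
    by (simp add: AE_all_countable)
  then show ?thesis
  proof eventually_elim
    case (elim \<omega>)
    show ?case
    proof
      fix t
      obtain m :: nat where "t \<le> real m"
        using real_arch_simple by blast
      moreover obtain n :: nat where "D (real n) \<omega> > real m"
        using elim by auto
      ultimately show "\<exists>r\<ge>0. D r \<omega> > t"
        by (intro exI[of _ "real n"]) simp
    qed
  qed
qed

text \<open>
  The duality between a monotone path and its inverse. The paths of \<open>D\<close> carry no
  continuity assumption, hence the two inclusions \<open>{E t > r} \<subseteq> {D r \<le> t}
  \<subseteq> {E t \<ge> r}\<close> instead of an equality.
\<close>

lemma E_good: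
  "AE \<omega> in L. \<forall>t\<ge>0. 0 \<le> E t \<omega> \<and> (\<forall>s. 0 \<le> s \<and> s \<le> t \<longrightarrow> E s \<omega> \<le> E t \<omega>) \<and>
     (\<forall>r\<ge>0. (r < E t \<omega> \<longrightarrow> D r \<omega> \<le> t) \<and> (D r \<omega> \<le> t \<longrightarrow> r \<le> E t \<omega>))"
  using D_mono_nonneg D_unbounded E_inverse
proof eventually_elim
  case (elim \<omega>)
  define S where "S t = {r. 0 \<le> r \<and> D r \<omega> > t}" for t
  have E_eq: "E t \<omega> = Inf (S t)" if "0 \<le> t" for t
    using elim(3) that by (simp add: S_def)
  have ne: "S t \<noteq> {}" for t
    using elim(2) by (auto simp: S_def)
  have bdd: "bdd_below (S t)" for t
    by (rule bdd_belowI[of _ 0]) (simp add: S_def)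
  have mono: "D r \<omega> \<le> D r' \<omega>" if "0 \<le> r" "r \<le> r'" for r r'
    using that by (intro mono_onD[OF conjunct1[OF elim(1)]]) auto
  show ?case
  proof (intro allI impI conjI)
    fix t :: real assume t: "0 \<le> t"
    show "0 \<le> E t \<omega>"
      unfolding E_eq[OF t] by (rule cInf_greatest[OF ne]) (simp add: S_def)
    show "E s \<omega> \<le> E t \<omega>" if "0 \<le> s \<and> s \<le> t" for s
    proof -
      have "S t \<subseteq> S s"
        using that by (auto simp: S_def)
      with that t show ?thesis
        by (simp add: E_eq cInf_superset_mono ne bdd)
    qed
    show "D r \<omega> \<le> t" if "0 \<le> r" "r < E t \<omega>" for r
    proof (rule ccontr)
      assume "\<not> D r \<omega> \<le> t"
      with that have "Inf (S t) \<le> r"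
        by (intro cInf_lower bdd) (simp add: S_def)
      with that show False
        by (simp add: E_eq[OF t])
    qed
    show "r \<le> E t \<omega>" if "0 \<le> r" "D r \<omega> \<le> t" for r
      unfolding E_eq[OF t]
    proof (rule cInf_greatest[OF ne])
      fix r' assume "r' \<in> S t"
      then have "0 \<le> r'" "t < D r' \<omega>"
        by (simp_all add: S_def)
      with that mono[of r' r] show "r \<le> r'"
        by linarith
    qed
  qed
qed

lemma E_nonneg: "0 \<le> t \<Longrightarrow> AE \<omega> in L. 0 \<le> E t \<omega>"
  using E_good by eventually_elim auto

lemma E_mono: "0 \<le> s \<Longrightarrow> s \<le> t \<Longrightarrow> AE \<omega> in L. 0 \<le> E s \<omega> \<and> E s \<omega> \<le> E t \<omega>"
  using E_good by eventually_elim auto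

lemma tail_E_le_D:
  assumes "0 \<le> r" "0 \<le> t"
  shows "emeasure L {\<omega> \<in> space L. r < E t \<omega>} \<le> emeasure L {\<omega> \<in> space L. D r \<omega> \<le> t}"
proof (rule emeasure_mono_AE)
  show "AE \<omega> in L. \<omega> \<in> {\<omega> \<in> space L. r < E t \<omega>} \<longrightarrow> \<omega> \<in> {\<omega> \<in> space L. D r \<omega> \<le> t}"
    using E_good by eventually_elim (use assms in auto)
qed (use D_measurable[OF assms(1)] in measurable)

lemma tail_D_le_E:
  assumes "0 \<le> r" "0 \<le> t"
  shows "emeasure L {\<omega> \<in> space L. D r \<omega> \<le> t} \<le> emeasure L {\<omega> \<in> space L. r \<le> E t \<omega>}"
proof (rule emeasure_mono_AE)
  show "AE \<omega> in L. \<omega> \<in> {\<omega> \<in> space L. D r \<omega> \<le> t} \<longrightarrow> \<omega> \<in> {\<omega> \<in> space L. r \<le> E t \<omega>}"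
    using E_good by eventually_elim (use assms in auto)
qed (use E_measurable[OF assms(2)] in measurable)

text \<open>
  \<open>D r / s\<close> and \<open>D (r / s\<^sup>\<beta>)\<close> have the same Laplace
  transform \<open>exp (- r (u / s)\<^sup>\<beta>)\<close>.
\<close>

lemma D_self_similar:
  assumes "0 < s" "0 \<le> r"
  shows "emeasure L {\<omega> \<in> space L. D r \<omega> \<le> s} =
         emeasure L {\<omega> \<in> space L. D (r / s powr \<beta>) \<omega> \<le> 1}"
proof -
  have r': "0 \<le> r / s powr \<beta>"
    using assms by simp
  have "measure L {\<omega> \<in> space L. D r \<omega> / s \<le> 1} = measure L {\<omega> \<in> space L. D (r / s powr \<beta>) \<omega> \<le> 1}"
  proof (rule laplace_transform_determines_cdf)
    fix n :: nat
    have "(LINT \<omega>|L. exp (- real n * (D r \<omega> / s))) = (LINT \<omega>|L. exp (- (real n / s) * D r \<omega>))"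
      by simp
    also have "\<dots> = exp (- r * (real n / s) powr \<beta>)"
      using assms by (intro D_laplace) auto
    also have "\<dots> = exp (- (r / s powr \<beta>) * real n powr \<beta>)"
      using assms by (simp add: powr_divide)
    also have "\<dots> = (LINT \<omega>|L. exp (- real n * D (r / s powr \<beta>) \<omega>))"
      using r' by (intro D_laplace[symmetric]) auto
    finally show "(LINT \<omega>|L. exp (- real n * (D r \<omega> / s))) =
        (LINT \<omega>|L. exp (- real n * D (r / s powr \<beta>) \<omega>))" .
  next
    show "AE \<omega> in L. 0 \<le> D r \<omega> / s"
      using D_nonneg[OF assms(2)] by eventually_elim (use assms in simp)
  qed (use D_measurable[OF assms(2)] D_measurable[OF r'] D_nonneg[OF r'] prob_space_axioms in simp_all)
  then show ?thesis
    using assms by (simp add: emeasure_eq_measure)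
qed

text \<open>
  By duality and the self-similarity of \<open>D\<close>, the strict tail of each side is below
  the weak tail of the other.
\<close>

lemma E_moment_self_similar:
  assumes s: "0 < s" and k: "0 < k"
  shows "(\<integral>\<^sup>+\<omega>. ennreal (E s \<omega> ^ k) \<partial>L) =
         (\<integral>\<^sup>+\<omega>. ennreal ((s powr \<beta> * E 1 \<omega>) ^ k) \<partial>L)"
proof (rule antisym)
  let ?c = "s powr \<beta>"
  have c: "0 < ?c" using s by simp
  note [measurable] = E_measurable[OF less_imp_le[OF s]] E_measurable[of 1]
  have root_less: "root k r < x" if "0 \<le> r" "0 \<le> x" "r < x ^ k" for r x
    using real_root_less_mono[OF k that(3)] k that by (simp add: real_root_power_cancel)
  have root_le: "r \<le> x ^ k" if "0 \<le> r" "root k r \<le> x" for r x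
    using power_mono[OF that(2), of k] k that by simp
  show "(\<integral>\<^sup>+\<omega>. ennreal (E s \<omega> ^ k) \<partial>L) \<le> (\<integral>\<^sup>+\<omega>. ennreal ((?c * E 1 \<omega>) ^ k) \<partial>L)"
  proof (rule nn_integral_tail_mono)
    fix r :: real assume r: "0 < r"
    then have root: "0 \<le> root k r"
      by (simp add: real_root_ge_zero)
    have "emeasure L {\<omega> \<in> space L. r < E s \<omega> ^ k} \<le> emeasure L {\<omega> \<in> space L. root k r < E s \<omega>}"
      by (rule emeasure_mono_AE, use E_nonneg[OF less_imp_le[OF s]] in eventually_elim)
         (use r s root_less[of r] in auto)
    also have "\<dots> \<le> emeasure L {\<omega> \<in> space L. D (root k r) \<omega> \<le> s}"
      using root s by (intro tail_E_le_D) auto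
    also have "\<dots> = emeasure L {\<omega> \<in> space L. D (root k r / ?c) \<omega> \<le> 1}"
      using root s by (intro D_self_similar) auto
    also have "\<dots> \<le> emeasure L {\<omega> \<in> space L. root k r / ?c \<le> E 1 \<omega>}"
      using root c by (intro tail_D_le_E) auto
    also have "\<dots> \<le> emeasure L {\<omega> \<in> space L. r \<le> (?c * E 1 \<omega>) ^ k}"
    proof (rule emeasure_mono)
      have "r \<le> (?c * x) ^ k" if "root k r / ?c \<le> x" for x
        using root_le[of r "?c * x"] r c that by (simp add: pos_divide_le_eq mult.commute)
      then show "{\<omega> \<in> space L. root k r / ?c \<le> E 1 \<omega>} \<subseteq> {\<omega> \<in> space L. r \<le> (?c * E 1 \<omega>) ^ k}"
        by blast
    qed simp
    finally show "emeasure L {\<omega> \<in> space L. r < E s \<omega> ^ k} \<le>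
        emeasure L {\<omega> \<in> space L. r \<le> (?c * E 1 \<omega>) ^ k}" .
  qed (use prob_space_axioms in measurable)
  show "(\<integral>\<^sup>+\<omega>. ennreal ((?c * E 1 \<omega>) ^ k) \<partial>L) \<le> (\<integral>\<^sup>+\<omega>. ennreal (E s \<omega> ^ k) \<partial>L)"
  proof (rule nn_integral_tail_mono)
    fix r :: real assume r: "0 < r"
    then have root: "0 \<le> root k r"
      by (simp add: real_root_ge_zero)
    have "emeasure L {\<omega> \<in> space L. r < (?c * E 1 \<omega>) ^ k} \<le>
        emeasure L {\<omega> \<in> space L. root k r / ?c < E 1 \<omega>}"
    proof (rule emeasure_mono_AE, use E_nonneg[OF zero_le_one] in eventually_elim)
      case (elim \<omega>)
      then show ?case
        using r c root_less[of r "?c * E 1 \<omega>"] by (auto simp: field_simps)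
    qed simp
    also have "\<dots> \<le> emeasure L {\<omega> \<in> space L. D (root k r / ?c) \<omega> \<le> 1}"
      using root c by (intro tail_E_le_D) auto
    also have "\<dots> = emeasure L {\<omega> \<in> space L. D (root k r) \<omega> \<le> s}"
      using root s by (intro D_self_similar[symmetric]) auto
    also have "\<dots> \<le> emeasure L {\<omega> \<in> space L. root k r \<le> E s \<omega>}"
      using root s by (intro tail_D_le_E) auto
    also have "\<dots> \<le> emeasure L {\<omega> \<in> space L. r \<le> E s \<omega> ^ k}"
      using r by (intro emeasure_mono) (auto intro!: root_le)
    finally show "emeasure L {\<omega> \<in> space L. r < (?c * E 1 \<omega>) ^ k} \<le>
        emeasure L {\<omega> \<in> space L. r \<le> E s \<omega> ^ k}" .
  qed (use prob_space_axioms in measurable)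
qed

text \<open>
  The tail of \<open>E 1\<close> is at most \<open>exp (1 - r)\<close>.
\<close>

lemma E_mean_finite: "(\<integral>\<^sup>+\<omega>. ennreal (E 1 \<omega>) \<partial>L) < \<infinity>"
proof -
  have "(\<integral>\<^sup>+\<omega>. ennreal (E 1 \<omega>) \<partial>L) =
      (\<integral>\<^sup>+r. emeasure L {\<omega> \<in> space L. r < E 1 \<omega>} * indicator {0<..} r \<partial>lborel)"
    using E_measurable[of 1] by (intro nn_integral_tail[symmetric]) (auto intro: prob_space_axioms)
  also have "\<dots> \<le> (\<integral>\<^sup>+r. ennreal (exp (1 - r)) * indicator {0..} r \<partial>lborel)"
  proof (rule nn_integral_mono)
    fix r :: real
    have "emeasure L {\<omega> \<in> space L. r < E 1 \<omega>} \<le> ennreal (exp (1 - r))" if "0 < r"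
    proof -
      have "emeasure L {\<omega> \<in> space L. r < E 1 \<omega>} \<le> emeasure L {\<omega> \<in> space L. D r \<omega> \<le> 1}"
        using that by (intro tail_E_le_D) auto
      also have "\<dots> \<le> ennreal (exp (1 - r))"
        using D_lower_tail[of r 1] that by (simp add: emeasure_eq_measure ennreal_leI)
      finally show ?thesis .
    qed
    then show "emeasure L {\<omega> \<in> space L. r < E 1 \<omega>} * indicator {0<..} r \<le>
        ennreal (exp (1 - r)) * indicator {0..} r"
      by (auto split: split_indicator)
  qed
  also have "\<dots> = ennreal (0 - (- exp (1 - 0)))"
  proof (rule nn_integral_FTC_atLeast)
    show "((\<lambda>r. - exp (1 - r)) \<longlongrightarrow> (0::real)) at_top"
      by real_asymp
  qed (auto intro!: derivative_eq_intros)
  also have "\<dots> < \<infinity>"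
    by simp
  finally show ?thesis .
qed

lemma D_joint_tail:
  assumes "0 < r" "0 < h"
  shows "emeasure L {\<omega> \<in> space L. D r \<omega> \<le> s \<and> D (r + h) \<omega> - D r \<omega> \<le> t} =
         emeasure L {\<omega> \<in> space L. D r \<omega> \<le> s} * emeasure L {\<omega> \<in> space L. D h \<omega> \<le> t}"
proof -
  have [measurable]: "D 0 \<in> borel_measurable L" "D r \<in> borel_measurable L"
    "D (r + h) \<in> borel_measurable L" "D h \<in> borel_measurable L"
    using assms by (auto intro: D_measurable)
  have start: "AE \<omega> in L. D 0 \<omega> = 0"
    and indep: "independent_increments L D" and stat: "stationary_increments L D"
    using D_subordinator by (simp_all add: subordinator_def)
  have "emeasure L {\<omega> \<in> space L. D r \<omega> \<le> s \<and> D (r + h) \<omega> - D r \<omega> \<le> t} =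
      (\<integral>\<^sup>+\<omega>. indicator {\<omega> \<in> space L. D r \<omega> \<le> s \<and> D (r + h) \<omega> - D r \<omega> \<le> t} \<omega> \<partial>L)"
    by simp
  also have "\<dots> = (\<integral>\<^sup>+\<omega>. indicator {..s} (D r \<omega> - D 0 \<omega>) * indicator {..t} (D (r + h) \<omega> - D r \<omega>) \<partial>L)"
    by (rule nn_integral_cong_AE, use start AE_space in eventually_elim) (auto split: split_indicator)
  also have "\<dots> = (\<integral>\<^sup>+\<omega>. indicator {..s} (D r \<omega> - D 0 \<omega>) \<partial>L) *
      (\<integral>\<^sup>+\<omega>. indicator {..t} (D (r + h) \<omega> - D r \<omega>) \<partial>L)"
    using assms by (intro independent_increments_nn_integral prob_space_axioms indep) auto
  also have "(\<integral>\<^sup>+\<omega>. indicator {..s} (D r \<omega> - D 0 \<omega>) \<partial>L) =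
      (\<integral>\<^sup>+\<omega>. indicator {\<omega> \<in> space L. D r \<omega> \<le> s} \<omega> \<partial>L)"
    by (rule nn_integral_cong_AE, use start AE_space in eventually_elim) (auto split: split_indicator)
  also have "\<dots> = emeasure L {\<omega> \<in> space L. D r \<omega> \<le> s}"
    by simp
  also have "(\<integral>\<^sup>+\<omega>. indicator {..t} (D (r + h) \<omega> - D r \<omega>) \<partial>L) =
      (\<integral>\<^sup>+x. indicator {..t} x \<partial>distr L borel (\<lambda>\<omega>. D (r + h) \<omega> - D r \<omega>))"
    by (rule nn_integral_distr[symmetric]) auto
  also have "\<dots> = (\<integral>\<^sup>+x. indicator {..t} x \<partial>distr L borel (\<lambda>\<omega>. D h \<omega> - D 0 \<omega>))"
    using stat assms by (simp add: stationary_increments_def)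
  also have "\<dots> = (\<integral>\<^sup>+\<omega>. indicator {..t} (D h \<omega> - D 0 \<omega>) \<partial>L)"
    by (rule nn_integral_distr) auto
  also have "\<dots> = (\<integral>\<^sup>+\<omega>. indicator {\<omega> \<in> space L. D h \<omega> \<le> t} \<omega> \<partial>L)"
    by (rule nn_integral_cong_AE, use start AE_space in eventually_elim) (auto split: split_indicator)
  also have "\<dots> = emeasure L {\<omega> \<in> space L. D h \<omega> \<le> t}"
    by simp
  finally show ?thesis .
qed

text \<open>
  If \<open>D r \<le> s\<close> and \<open>D (r + h) \<le> t\<close>, then the increment \<open>D
  (r + h) - D r\<close> is at most \<open>t\<close> because \<open>D r \<ge> 0\<close>. The
  increment is independent of \<open>D r\<close>, so the joint tail is below a product of tails,
  whose integral factorises.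
\<close>

lemma E_product_upper:
  assumes "0 \<le> s" "s \<le> t"
  shows "(\<integral>\<^sup>+\<omega>. ennreal (E s \<omega> * E t \<omega> - (E s \<omega>)\<^sup>2 / 2) \<partial>L) \<le>
         (\<integral>\<^sup>+\<omega>. ennreal (E s \<omega>) \<partial>L) * (\<integral>\<^sup>+\<omega>. ennreal (E t \<omega>) \<partial>L)"
proof -
  have t: "0 \<le> t" using assms by simp
  note [measurable] = E_measurable[OF assms(1)] E_measurable[OF t]
  have pointwise: "emeasure L {\<omega> \<in> space L. r < E s \<omega> \<and> r + h < E t \<omega>} \<le>
      emeasure L {\<omega> \<in> space L. r \<le> E s \<omega>} * emeasure L {\<omega> \<in> space L. h \<le> E t \<omega>}"
    if rh: "0 < r" "0 < h" for r h
  proof -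
    have [measurable]: "D r \<in> borel_measurable L" "D (r + h) \<in> borel_measurable L"
      using rh by (auto intro: D_measurable)
    have "emeasure L {\<omega> \<in> space L. r < E s \<omega> \<and> r + h < E t \<omega>} \<le>
        emeasure L {\<omega> \<in> space L. D r \<omega> \<le> s \<and> D (r + h) \<omega> - D r \<omega> \<le> t}"
    proof (rule emeasure_mono_AE, use E_good D_nonneg[OF less_imp_le[OF rh(1)]] in eventually_elim)
      case (elim \<omega>)
      show ?case
      proof (intro impI, clarify)
        assume "\<omega> \<in> space L" "r < E s \<omega>" "r + h < E t \<omega>"
        then have "D r \<omega> \<le> s" "D (r + h) \<omega> \<le> t"
          using elim(1) rh assms(1) t by auto
        with elim(2) show "D r \<omega> \<le> s \<and> D (r + h) \<omega> - D r \<omega> \<le> t"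
          by simp
      qed
    qed (use rh in auto)
    also have "\<dots> \<le> emeasure L {\<omega> \<in> space L. r \<le> E s \<omega>} * emeasure L {\<omega> \<in> space L. h \<le> E t \<omega>}"
      unfolding D_joint_tail[OF rh] using rh assms by (intro mult_mono tail_D_le_E) auto
    finally show ?thesis .
  qed
  have "(\<integral>\<^sup>+\<omega>. ennreal (E s \<omega> * E t \<omega> - (E s \<omega>)\<^sup>2 / 2) \<partial>L) =
      (\<integral>\<^sup>+r. (\<integral>\<^sup>+h. emeasure L {\<omega> \<in> space L. r < E s \<omega> \<and> r + h < E t \<omega>} * indicator {0<..} h \<partial>lborel)
         * indicator {0<..} r \<partial>lborel)"
    by (rule nn_integral_joint_tail[symmetric]) (use E_mono[OF assms] prob_space_axioms in auto)
  also have "\<dots> \<le> (\<integral>\<^sup>+r. (\<integral>\<^sup>+h. emeasure L {\<omega> \<in> space L. r \<le> E s \<omega>} * emeasure L {\<omega> \<in> space L. h \<le> E t \<omega>}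
       * indicator {0<..} h \<partial>lborel) * indicator {0<..} r \<partial>lborel)"
    using pointwise by (auto intro!: nn_integral_mono split: split_indicator)
  also have "\<dots> = (\<integral>\<^sup>+\<omega>. ennreal (E s \<omega>) \<partial>L) * (\<integral>\<^sup>+\<omega>. ennreal (E t \<omega>) \<partial>L)"
    by (rule nn_integral_product_tails[symmetric]) (use prob_space_axioms in auto)
  finally show ?thesis .
qed

text \<open>
  Conversely, \<open>D r \<le> s\<close> and an increment of at most \<open>t - s\<close> force
  \<open>D (r + h) \<le> t\<close>.
\<close>

lemma E_product_lower:
  assumes "0 \<le> s" "s \<le> t"
  shows "(\<integral>\<^sup>+\<omega>. ennreal (E s \<omega>) \<partial>L) * (\<integral>\<^sup>+\<omega>. ennreal (E (t - s) \<omega>) \<partial>L) \<le>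
         (\<integral>\<^sup>+\<omega>. ennreal (E s \<omega> * E t \<omega> - (E s \<omega>)\<^sup>2 / 2) \<partial>L)"
proof -
  have t: "0 \<le> t" "0 \<le> t - s" using assms by simp_all
  note [measurable] = E_measurable[OF assms(1)] E_measurable[OF t(1)] E_measurable[OF t(2)]
  have pointwise: "emeasure L {\<omega> \<in> space L. r < E s \<omega>} * emeasure L {\<omega> \<in> space L. h < E (t - s) \<omega>} \<le>
      emeasure L {\<omega> \<in> space L. r \<le> E s \<omega> \<and> r + h \<le> E t \<omega>}"
    if rh: "0 < r" "0 < h" for r h
  proof -
    have "emeasure L {\<omega> \<in> space L. r < E s \<omega>} * emeasure L {\<omega> \<in> space L. h < E (t - s) \<omega>} \<le>
        emeasure L {\<omega> \<in> space L. D r \<omega> \<le> s \<and> D (r + h) \<omega> - D r \<omega> \<le> t - s}"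
      unfolding D_joint_tail[OF rh] using rh assms by (intro mult_mono tail_E_le_D) auto
    also have "\<dots> \<le> emeasure L {\<omega> \<in> space L. r \<le> E s \<omega> \<and> r + h \<le> E t \<omega>}"
    proof (rule emeasure_mono_AE, use E_good in eventually_elim)
      case (elim \<omega>)
      show ?case
      proof (intro impI, clarify)
        assume "\<omega> \<in> space L" "D r \<omega> \<le> s" "D (r + h) \<omega> - D r \<omega> \<le> t - s"
        then have "D r \<omega> \<le> s" "D (r + h) \<omega> \<le> t"
          by simp_all
        then show "r \<le> E s \<omega> \<and> r + h \<le> E t \<omega>"
          using elim rh assms(1) t by auto
      qed
    qed auto
    finally show ?thesis .
  qed
  have "(\<integral>\<^sup>+\<omega>. ennreal (E s \<omega>) \<partial>L) * (\<integral>\<^sup>+\<omega>. ennreal (E (t - s) \<omega>) \<partial>L) =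
      (\<integral>\<^sup>+r. (\<integral>\<^sup>+h. emeasure L {\<omega> \<in> space L. r < E s \<omega>} * emeasure L {\<omega> \<in> space L. h < E (t - s) \<omega>}
       * indicator {0<..} h \<partial>lborel) * indicator {0<..} r \<partial>lborel)"
    by (rule nn_integral_product_tails) (use prob_space_axioms in auto)
  also have "\<dots> \<le>
      (\<integral>\<^sup>+r. (\<integral>\<^sup>+h. emeasure L {\<omega> \<in> space L. r \<le> E s \<omega> \<and> r + h \<le> E t \<omega>} * indicator {0<..} h \<partial>lborel)
         * indicator {0<..} r \<partial>lborel)"
    using pointwise by (auto intro!: nn_integral_mono split: split_indicator)
  also have "\<dots> = (\<integral>\<^sup>+\<omega>. ennreal (E s \<omega> * E t \<omega> - (E s \<omega>)\<^sup>2 / 2) \<partial>L)"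
    by (rule nn_integral_joint_tail) (use E_mono[OF assms] prob_space_axioms in auto)
  finally show ?thesis .
qed

definition m1 :: real where "m1 = (LINT \<omega>|L. E 1 \<omega>)"
definition m2 :: real where "m2 = (LINT \<omega>|L. (E 1 \<omega>)\<^sup>2)"

text \<open>
  The upper product bound for \<open>s = t\<close> bounds half the second moment by the square of
  the mean.
\<close>

lemma E_second_moment_finite: "(\<integral>\<^sup>+\<omega>. ennreal ((E 1 \<omega>)\<^sup>2) \<partial>L) < \<infinity>"
proof -
  note [measurable] = E_measurable[OF zero_le_one]
  have "(\<integral>\<^sup>+\<omega>. ennreal ((E 1 \<omega>)\<^sup>2) \<partial>L) =
      (\<integral>\<^sup>+\<omega>. 2 * ennreal (E 1 \<omega> * E 1 \<omega> - (E 1 \<omega>)\<^sup>2 / 2) \<partial>L)"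
    by (rule nn_integral_cong) (simp add: power2_eq_square flip: ennreal_numeral ennreal_mult')
  also have "\<dots> = 2 * (\<integral>\<^sup>+\<omega>. ennreal (E 1 \<omega> * E 1 \<omega> - (E 1 \<omega>)\<^sup>2 / 2) \<partial>L)"
    by (rule nn_integral_cmult) measurable
  also have "\<dots> \<le> 2 * ((\<integral>\<^sup>+\<omega>. ennreal (E 1 \<omega>) \<partial>L) * (\<integral>\<^sup>+\<omega>. ennreal (E 1 \<omega>) \<partial>L))"
    by (intro mult_left_mono E_product_upper) auto
  also have "\<dots> < \<infinity>"
    using E_mean_finite by (simp add: ennreal_mult_less_top)
  finally show ?thesis .
qed

lemma integrable_E: "integrable L (\<lambda>\<omega>. E 1 \<omega>)" "integrable L (\<lambda>\<omega>. (E 1 \<omega>)\<^sup>2)"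
  using E_measurable[OF zero_le_one] E_mean_finite E_second_moment_finite E_nonneg[OF zero_le_one]
  by (auto intro!: integrableI_nonneg)

lemma m1_nonneg: "0 \<le> m1"
  unfolding m1_def by (rule integral_nonneg_AE) (rule E_nonneg[OF zero_le_one])

lemma E_moments:
  assumes s: "0 < s"
  shows "(\<integral>\<^sup>+\<omega>. ennreal (E s \<omega>) \<partial>L) = ennreal (m1 * s powr \<beta>)"
    and "(\<integral>\<^sup>+\<omega>. ennreal ((E s \<omega>)\<^sup>2) \<partial>L) = ennreal (m2 * s powr (2 * \<beta>))"
proof -
  note [measurable] = E_measurable[OF zero_le_one]
  have "(\<integral>\<^sup>+\<omega>. ennreal (E s \<omega>) \<partial>L) = (\<integral>\<^sup>+\<omega>. ennreal (s powr \<beta> * E 1 \<omega>) \<partial>L)"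
    using E_moment_self_similar[OF s, of 1] by simp
  also have "\<dots> = ennreal (LINT \<omega>|L. s powr \<beta> * E 1 \<omega>)"
    by (rule nn_integral_eq_integral)
       (use integrable_E E_nonneg[OF zero_le_one] in \<open>auto elim: eventually_mono\<close>)
  finally show "(\<integral>\<^sup>+\<omega>. ennreal (E s \<omega>) \<partial>L) = ennreal (m1 * s powr \<beta>)"
    by (simp add: m1_def mult.commute)
  have "(\<integral>\<^sup>+\<omega>. ennreal ((E s \<omega>)\<^sup>2) \<partial>L) = (\<integral>\<^sup>+\<omega>. ennreal ((s powr \<beta>)\<^sup>2 * (E 1 \<omega>)\<^sup>2) \<partial>L)"
    using E_moment_self_similar[OF s, of 2] by (simp add: power_mult_distrib)
  also have "\<dots> = ennreal (LINT \<omega>|L. (s powr \<beta>)\<^sup>2 * (E 1 \<omega>)\<^sup>2)"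
    by (rule nn_integral_eq_integral) (use integrable_E in auto)
  also have "(s powr \<beta>)\<^sup>2 = s powr (2 * \<beta>)"
    by (simp add: power2_eq_square powr_add[symmetric])
  finally show "(\<integral>\<^sup>+\<omega>. ennreal ((E s \<omega>)\<^sup>2) \<partial>L) = ennreal (m2 * s powr (2 * \<beta>))"
    by (simp add: m2_def mult.commute)
qed

text \<open>
  If \<open>E 1\<close> were a constant \<open>c\<close>, then \<open>D r \<le> 1\<close> almost
  surely for \<open>r < c\<close>, hence \<open>exp (- r u\<^sup>\<beta>) \<ge> exp (- u)\<close>
  for all \<open>u\<close>, which fails for small \<open>u\<close> as \<open>\<beta> < 1\<close>.
  If \<open>c \<le> 0\<close>, then \<open>D (1/2) > 1\<close> almost surely, which contradicts
  the Laplace transform at \<open>u = 1\<close>.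
\<close>

lemma E_not_constant: "\<not> (AE \<omega> in L. E 1 \<omega> = c)"
proof
  assume const: "AE \<omega> in L. E 1 \<omega> = c"
  note [measurable] = E_measurable[OF zero_le_one]
  show False
  proof (cases "0 < c")
    case True
    define r where "r = c / 2"
    have r: "0 < r" "r < c"
      using True by (auto simp: r_def)
    note [measurable] = D_measurable[OF less_imp_le[OF r(1)]]
    have "AE \<omega> in L. \<omega> \<in> {\<omega> \<in> space L. r < E 1 \<omega>}"
      using const AE_space by eventually_elim (use r in auto)
    then have "emeasure L {\<omega> \<in> space L. r < E 1 \<omega>} = 1"
      by (intro emeasure_eq_1_AE) auto
    with tail_E_le_D[of r 1] r have "1 \<le> emeasure L {\<omega> \<in> space L. D r \<omega> \<le> 1}"
      by simp
    then have "prob {\<omega> \<in> space L. D r \<omega> \<le> 1} = 1"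
      by (simp add: emeasure_eq_measure antisym)
    then have D_le: "AE \<omega> in L. D r \<omega> \<le> 1"
      by (subst (asm) prob_Collect_eq_1) auto
    \<comment> \<open>chosen so that \<open>u powr (1 - \<beta>) = r / 2\<close> is smaller than \<open>r\<close>\<close>
    define u where "u = (r / 2) powr (1 / (1 - \<beta>))"
    have u: "0 < u" "u powr (1 - \<beta>) = r / 2"
      using r \<beta> by (simp_all add: u_def powr_powr)
    have "exp (- u) = (LINT \<omega>|L. exp (- u))"
      by (simp add: prob_space)
    also have "\<dots> \<le> (LINT \<omega>|L. exp (- u * D r \<omega>))"
    proof (rule integral_mono_AE)
      show "integrable L (\<lambda>\<omega>. exp (- u * D r \<omega>))"
        using r u by (intro integrable_exp_D) auto
      show "AE \<omega> in L. exp (- u) \<le> exp (- u * D r \<omega>)"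
        using D_le by eventually_elim (use u in \<open>simp add: mult_left_le\<close>)
    qed simp
    also have "\<dots> = exp (- r * u powr \<beta>)"
      using r u by (intro D_laplace) auto
    finally have "r * u powr \<beta> \<le> u"
      by simp
    moreover have "u = (r / 2) * u powr \<beta>"
      unfolding u(2)[symmetric] using u(1) by (simp add: powr_add[symmetric])
    ultimately have "r * u powr \<beta> \<le> (r / 2) * u powr \<beta>"
      by linarith
    then have "r \<le> r / 2"
      using u(1) by (subst (asm) mult_le_cancel_right_pos) auto
    with r show False by simp
  next
    case False
    note [measurable] = D_measurable[of "1/2", simplified]
    have "emeasure L {\<omega> \<in> space L. D (1/2) \<omega> \<le> 1} \<le> emeasure L {\<omega> \<in> space L. 1/2 \<le> E 1 \<omega>}"
      by (rule tail_D_le_E) auto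
    also have "\<dots> = 0"
      using const False by (intro emeasure_eq_0_AE) (auto elim: eventually_mono)
    finally have "AE \<omega> in L. \<omega> \<notin> {\<omega> \<in> space L. D (1/2) \<omega> \<le> 1}"
      by (intro AE_not_in) (auto simp: null_sets_def)
    then have D_gt: "AE \<omega> in L. 1 < D (1/2) \<omega>"
      using AE_space by eventually_elim auto
    have "exp (- (1/2)) = (LINT \<omega>|L. exp (- 1 * D (1/2) \<omega>))"
      using D_laplace[of "1/2" 1] by simp
    also have "\<dots> \<le> (LINT \<omega>|L. exp (- 1))"
    proof (rule integral_mono_AE)
      show "integrable L (\<lambda>\<omega>. exp (- 1 * D (1/2) \<omega>))"
        by (intro integrable_exp_D) auto
      show "AE \<omega> in L. exp (- 1 * D (1/2) \<omega>) \<le> exp (- 1)"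
        using D_gt by eventually_elim simp
    qed simp
    finally show False
      by (simp add: prob_space)
  qed
qed

lemma m1_m2: "m1\<^sup>2 < m2"
proof -
  have var: "variance (E 1) = m2 - m1\<^sup>2"
    unfolding m1_def m2_def by (rule variance_eq) (rule integrable_E)+
  have int: "integrable L (\<lambda>\<omega>. (E 1 \<omega> - m1)\<^sup>2)"
    unfolding power2_diff using integrable_E by auto
  have "variance (E 1) \<noteq> 0"
  proof
    assume "variance (E 1) = 0"
    then have "AE \<omega> in L. (E 1 \<omega> - m1)\<^sup>2 = 0"
      using int by (subst (asm) integral_nonneg_eq_0_iff_AE) (auto simp: m1_def)
    then have "AE \<omega> in L. E 1 \<omega> = m1"
      by eventually_elim simp
    with E_not_constant show False by blast
  qed
  moreover have "0 \<le> variance (E 1)"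
    by (rule variance_positive)
  ultimately show ?thesis
    using var by linarith
qed

lemma m2_pos: "0 < m2"
  using m1_m2 by (smt (verit) zero_le_power2)

text \<open>
  The two bounds share the leading term and differ by \<open>m1\<^sup>2 s\<^sup>\<beta>
  (t\<^sup>\<beta> - (t - s)\<^sup>\<beta>)\<close>, which vanishes as \<open>t\<close> grows.
\<close>

lemma E_product_moment_bounds:
  assumes st: "0 < s" "s < t"
  shows "ennreal (m2 / 2 * s powr (2 * \<beta>) + m1\<^sup>2 * (s powr \<beta> * (t - s) powr \<beta>)) \<le>
           (\<integral>\<^sup>+\<omega>. ennreal (E s \<omega> * E t \<omega>) \<partial>L)"
    and "(\<integral>\<^sup>+\<omega>. ennreal (E s \<omega> * E t \<omega>) \<partial>L) \<le>
           ennreal (m2 / 2 * s powr (2 * \<beta>) + m1\<^sup>2 * (s powr \<beta> * t powr \<beta>))"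
proof -
  have t: "0 < t" "0 < t - s" using st by simp_all
  note [measurable] = E_measurable[OF less_imp_le[OF st(1)]] E_measurable[OF less_imp_le[OF t(1)]]
  let ?A = "\<integral>\<^sup>+\<omega>. ennreal (E s \<omega> * E t \<omega> - (E s \<omega>)\<^sup>2 / 2) \<partial>L"
  have mono: "AE \<omega> in L. 0 \<le> E s \<omega> \<and> E s \<omega> \<le> E t \<omega>"
    by (rule E_mono) (use st in auto)
  have "(\<integral>\<^sup>+\<omega>. ennreal (E s \<omega> * E t \<omega>) \<partial>L) =
      (\<integral>\<^sup>+\<omega>. ennreal ((E s \<omega>)\<^sup>2 / 2) + ennreal (E s \<omega> * E t \<omega> - (E s \<omega>)\<^sup>2 / 2) \<partial>L)"
  proof (rule nn_integral_cong_AE, use mono in eventually_elim)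
    case (elim \<omega>)
    then have "(E s \<omega>)\<^sup>2 \<le> E s \<omega> * E t \<omega>"
      unfolding power2_eq_square by (intro mult_left_mono) auto
    moreover have "0 \<le> (E s \<omega>)\<^sup>2" by simp
    ultimately have "0 \<le> E s \<omega> * E t \<omega> - (E s \<omega>)\<^sup>2 / 2"
      by linarith
    then show ?case
      by (subst ennreal_plus[symmetric]) auto
  qed
  also have "\<dots> = (\<integral>\<^sup>+\<omega>. ennreal ((E s \<omega>)\<^sup>2 / 2) \<partial>L) + ?A"
    by (rule nn_integral_add) measurable
  also have "(\<integral>\<^sup>+\<omega>. ennreal ((E s \<omega>)\<^sup>2 / 2) \<partial>L) =
      (\<integral>\<^sup>+\<omega>. ennreal (1 / 2) * ennreal ((E s \<omega>)\<^sup>2) \<partial>L)"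
    by (rule nn_integral_cong) (subst ennreal_mult'[symmetric], auto)
  also have "\<dots> = ennreal (1 / 2) * ennreal (m2 * s powr (2 * \<beta>))"
    unfolding E_moments(2)[OF st(1), symmetric] by (rule nn_integral_cmult) measurable
  also have "\<dots> = ennreal (m2 / 2 * s powr (2 * \<beta>))"
    by (subst ennreal_mult'[symmetric]) auto
  finally have eq: "(\<integral>\<^sup>+\<omega>. ennreal (E s \<omega> * E t \<omega>) \<partial>L) = ennreal (m2 / 2 * s powr (2 * \<beta>)) + ?A" .
  have prod: "ennreal (m1 * s powr \<beta>) * ennreal (m1 * x powr \<beta>) = ennreal (m1\<^sup>2 * (s powr \<beta> * x powr \<beta>))" for x
    using m1_nonneg by (simp add: ennreal_mult'[symmetric] power2_eq_square mult_ac)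
  have split: "ennreal (m2 / 2 * s powr (2 * \<beta>) + m1\<^sup>2 * (s powr \<beta> * x powr \<beta>)) =
      ennreal (m2 / 2 * s powr (2 * \<beta>)) + ennreal (m1\<^sup>2 * (s powr \<beta> * x powr \<beta>))" for x
    using m2_pos by (intro ennreal_plus) auto
  show "ennreal (m2 / 2 * s powr (2 * \<beta>) + m1\<^sup>2 * (s powr \<beta> * (t - s) powr \<beta>)) \<le>
      (\<integral>\<^sup>+\<omega>. ennreal (E s \<omega> * E t \<omega>) \<partial>L)"
    unfolding eq split using E_product_lower[of s t] st
    by (intro add_left_mono) (simp add: E_moments prod)
  show "(\<integral>\<^sup>+\<omega>. ennreal (E s \<omega> * E t \<omega>) \<partial>L) \<le>
      ennreal (m2 / 2 * s powr (2 * \<beta>) + m1\<^sup>2 * (s powr \<beta> * t powr \<beta>))"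
    unfolding eq split using E_product_upper[of s t] st
    by (intro add_left_mono) (simp add: E_moments prod)
qed

end

section \<open>Moments of the fractional Poisson process\<close>

lemma same_fdd_nn_integral:
  fixes X :: "real \<Rightarrow> 'a \<Rightarrow> nat" and Z :: "real \<Rightarrow> 'b \<Rightarrow> nat" and h :: "nat \<Rightarrow> nat \<Rightarrow> ennreal"
  assumes fdd: "same_fdd M X L Z (count_space UNIV)" and ab: "0 \<le> a" "0 \<le> b"
  shows "(\<integral>\<^sup>+\<omega>. h (X a \<omega>) (X b \<omega>) \<partial>M) = (\<integral>\<^sup>+\<omega>. h (Z a \<omega>) (Z b \<omega>) \<partial>L)"
proof -
  let ?J = "{a, b}" and ?C = "count_space UNIV :: nat measure"
  let ?P = "PiM ?J (\<lambda>_. ?C)"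
  have comp: "(\<lambda>x. x c) \<in> measurable ?P ?C" if "c \<in> ?J" for c
    by (rule measurable_component_singleton[OF that])
  have h: "(\<lambda>x. h (x a) (x b)) \<in> borel_measurable ?P"
    by (rule measurable_compose_countable[where f = "\<lambda>i x. h i (x b)" and g = "\<lambda>x. x a", OF _ comp])
       (auto intro: measurable_compose[OF comp])
  have eq: "distr M ?P (\<lambda>\<omega>. \<lambda>t\<in>?J. X t \<omega>) = distr L ?P (\<lambda>\<omega>. \<lambda>t\<in>?J. Z t \<omega>)"
    using fdd ab by (auto simp: same_fdd_def)
  have X: "(\<lambda>\<omega>. \<lambda>t\<in>?J. X t \<omega>) \<in> measurable M ?P" and Z: "(\<lambda>\<omega>. \<lambda>t\<in>?J. Z t \<omega>) \<in> measurable L ?P"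
    using fdd ab by (auto simp: same_fdd_def process_def intro!: measurable_restrict)
  have "(\<integral>\<^sup>+\<omega>. h (X a \<omega>) (X b \<omega>) \<partial>M) =
      (\<integral>\<^sup>+x. h (x a) (x b) \<partial>distr M ?P (\<lambda>\<omega>. \<lambda>t\<in>?J. X t \<omega>))"
    by (subst nn_integral_distr[OF X]) (use h in simp_all)
  also have "\<dots> = (\<integral>\<^sup>+\<omega>. h (Z a \<omega>) (Z b \<omega>) \<partial>L)"
    unfolding eq by (subst nn_integral_distr[OF Z]) (use h in simp_all)
  finally show ?thesis .
qed

text \<open>
  The part of the fractional Poisson law that matters for correlations: powers of time with
  coefficients \<open>A = rate * m1\<close> and \<open>B = rate\<^sup>2 * m2\<close>. The strict
  inequality \<open>A\<^sup>2 < B\<close> is what later makes the variance grow at the full rate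
  \<open>t powr (2 * \<beta>)\<close>.
\<close>

lemma fractional_poisson_moments:
  assumes \<beta>: "0 < \<beta>" "\<beta> < 1" and rate: "0 < rate" and L: "prob_space L"
    and fpp: "fractional_poisson_process \<beta> rate L M X"
  obtains A B where "0 \<le> A" "A\<^sup>2 < B"
    and "\<And>t. 0 < t \<Longrightarrow> (\<integral>\<^sup>+\<omega>. ennreal (real (X t \<omega>)) \<partial>M) = ennreal (A * t powr \<beta>)"
    and "\<And>t. 0 < t \<Longrightarrow> (\<integral>\<^sup>+\<omega>. ennreal ((real (X t \<omega>))\<^sup>2) \<partial>M) =
           ennreal (A * t powr \<beta> + B * t powr (2 * \<beta>))"
    and "\<And>s t. 0 < s \<Longrightarrow> s < t \<Longrightarrow>
           ennreal (A * s powr \<beta> + B / 2 * s powr (2 * \<beta>) + A\<^sup>2 * (s powr \<beta> * (t - s) powr \<beta>))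
           \<le> (\<integral>\<^sup>+\<omega>. ennreal (real (X s \<omega>) * real (X t \<omega>)) \<partial>M)"
    and "\<And>s t. 0 < s \<Longrightarrow> s < t \<Longrightarrow>
           (\<integral>\<^sup>+\<omega>. ennreal (real (X s \<omega>) * real (X t \<omega>)) \<partial>M)
           \<le> ennreal (A * s powr \<beta> + B / 2 * s powr (2 * \<beta>) + A\<^sup>2 * (s powr \<beta> * t powr \<beta>))"
proof -
  obtain N E W where N: "poisson_process rate L N" and E: "inverse_stable_subordinator \<beta> L E"
    and indep: "independent_processes L (\<lambda>t \<omega>. real (N t \<omega>)) E"
    and tc: "time_change L N E W" and fdd: "same_fdd M X L W (count_space UNIV)"
    using fpp by (auto simp: fractional_poisson_process_def)
  obtain D where "process L borel E" "stable_subordinator \<beta> L D"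
    "AE \<omega> in L. \<forall>t\<ge>0. E t \<omega> = Inf {r. 0 \<le> r \<and> D r \<omega> > t}"
    using E by (auto simp: inverse_stable_subordinator_def)
  then interpret stable_inverse L \<beta> D E
    using L \<beta> by (simp add: stable_inverse_def stable_inverse_axioms_def)
  have rc: "right_continuous_paths L N"
    using N by (simp add: poisson_process_def)
  have X_moment: "(\<integral>\<^sup>+\<omega>. h (X s \<omega>) (X t \<omega>) \<partial>M) =
      (\<integral>\<^sup>+\<omega>. (\<integral>\<^sup>+\<omega>'. h (N (E s \<omega>) \<omega>') (N (E t \<omega>) \<omega>') \<partial>L) \<partial>L)"
    if "0 \<le> s" "0 \<le> t" for s t h
    unfolding same_fdd_nn_integral[OF fdd that]
    by (rule nn_integral_time_change[OF L indep rc tc E_nonneg[OF that(1)] E_nonneg[OF that(2)] that])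
  have mean: "(\<integral>\<^sup>+\<omega>. ennreal (real (X t \<omega>)) \<partial>M) = ennreal (rate * m1 * t powr \<beta>)" if t: "0 < t" for t
  proof -
    note [measurable] = E_measurable[OF less_imp_le[OF t]]
    have "(\<integral>\<^sup>+\<omega>. ennreal (real (X t \<omega>)) \<partial>M) = (\<integral>\<^sup>+\<omega>. ennreal rate * ennreal (E t \<omega>) \<partial>L)"
      unfolding X_moment[OF less_imp_le[OF t] less_imp_le[OF t], of "\<lambda>i _. ennreal (real i)"]
      by (rule nn_integral_cong_AE, use E_nonneg[OF less_imp_le[OF t]] in eventually_elim)
         (use rate in \<open>simp add: poisson_mean[OF L N rate] ennreal_mult'\<close>)
    also have "\<dots> = ennreal rate * ennreal (m1 * t powr \<beta>)"
      by (simp add: nn_integral_cmult E_moments[OF t])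
    finally show ?thesis
      using rate by (simp add: ennreal_mult'[symmetric] mult.assoc)
  qed
  have product: "(\<integral>\<^sup>+\<omega>. ennreal (real (X s \<omega>) * real (X t \<omega>)) \<partial>M) =
      ennreal (rate * m1 * s powr \<beta>) + ennreal (rate\<^sup>2) * (\<integral>\<^sup>+\<omega>. ennreal (E s \<omega> * E t \<omega>) \<partial>L)"
    if s: "0 < s" and st: "s \<le> t" for s t
  proof -
    have t: "0 \<le> t" using s st by simp
    note [measurable] = E_measurable[OF less_imp_le[OF s]] E_measurable[OF t]
    have "(\<integral>\<^sup>+\<omega>. ennreal (real (X s \<omega>) * real (X t \<omega>)) \<partial>M) =
        (\<integral>\<^sup>+\<omega>. ennreal rate * ennreal (E s \<omega>) + ennreal (rate\<^sup>2) * ennreal (E s \<omega> * E t \<omega>) \<partial>L)"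
      unfolding X_moment[OF less_imp_le[OF s] t, of "\<lambda>i j. ennreal (real i * real j)"]
    proof (rule nn_integral_cong_AE, use E_mono[OF less_imp_le[OF s] st] in eventually_elim)
      case (elim \<omega>)
      then have "(\<integral>\<^sup>+\<omega>'. ennreal (real (N (E s \<omega>) \<omega>') * real (N (E t \<omega>) \<omega>')) \<partial>L) =
          ennreal (rate * E s \<omega> + rate\<^sup>2 * E s \<omega> * E t \<omega>)"
        by (intro poisson_product_moment[OF L N rate]) auto
      also have "\<dots> = ennreal rate * ennreal (E s \<omega>) + ennreal (rate\<^sup>2) * ennreal (E s \<omega> * E t \<omega>)"
        using rate elim by (simp add: ennreal_plus ennreal_mult' mult.assoc)
      finally show ?case .
    qed
    also have "\<dots> = ennreal rate * (\<integral>\<^sup>+\<omega>. ennreal (E s \<omega>) \<partial>L) +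
        ennreal (rate\<^sup>2) * (\<integral>\<^sup>+\<omega>. ennreal (E s \<omega> * E t \<omega>) \<partial>L)"
      by (simp add: nn_integral_add nn_integral_cmult)
    finally show ?thesis
      using rate by (simp add: E_moments[OF s] ennreal_mult'[symmetric] mult.assoc)
  qed
  have split: "ennreal (rate * m1 * s powr \<beta> + rate\<^sup>2 * m2 / 2 * x + (rate * m1)\<^sup>2 * y) =
      ennreal (rate * m1 * s powr \<beta>) + ennreal (rate\<^sup>2) * ennreal (m2 / 2 * x + m1\<^sup>2 * y)"
    if "0 \<le> x" "0 \<le> y" for s x y
  proof -
    have "rate * m1 * s powr \<beta> + rate\<^sup>2 * m2 / 2 * x + (rate * m1)\<^sup>2 * y =
        rate * m1 * s powr \<beta> + rate\<^sup>2 * (m2 / 2 * x + m1\<^sup>2 * y)"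
      by (simp add: power_mult_distrib algebra_simps)
    also have "ennreal \<dots> = ennreal (rate * m1 * s powr \<beta>) + ennreal (rate\<^sup>2 * (m2 / 2 * x + m1\<^sup>2 * y))"
      using that rate m1_nonneg m2_pos by (intro ennreal_plus) auto
    finally show ?thesis
      by (simp add: ennreal_mult')
  qed
  show thesis
  proof (rule that)
    show "0 \<le> rate * m1" "(rate * m1)\<^sup>2 < rate\<^sup>2 * m2"
      using rate m1_nonneg m1_m2 by (simp_all add: power_mult_distrib)
    show "(\<integral>\<^sup>+\<omega>. ennreal (real (X t \<omega>)) \<partial>M) = ennreal (rate * m1 * t powr \<beta>)" if "0 < t" for t
      by (rule mean[OF that])
    show "(\<integral>\<^sup>+\<omega>. ennreal ((real (X t \<omega>))\<^sup>2) \<partial>M) =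
        ennreal (rate * m1 * t powr \<beta> + rate\<^sup>2 * m2 * t powr (2 * \<beta>))" if "0 < t" for t
    proof -
      have "(\<integral>\<^sup>+\<omega>. ennreal ((real (X t \<omega>))\<^sup>2) \<partial>M) =
          ennreal (rate * m1 * t powr \<beta>) + ennreal (rate\<^sup>2) * ennreal (m2 * t powr (2 * \<beta>))"
        using product[OF that order_refl] E_moments(2)[OF that] unfolding power2_eq_square[of "real _"]
          power2_eq_square[of "E _ _"] by simp
      also have "\<dots> = ennreal (rate * m1 * t powr \<beta> + rate\<^sup>2 * (m2 * t powr (2 * \<beta>)))"
        using rate m1_nonneg m2_pos by (simp add: ennreal_mult' ennreal_plus)
      finally show ?thesis
        by (simp add: mult.assoc)
    qed
    fix s t :: real assume st: "0 < s" "s < t"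
    show "ennreal (rate * m1 * s powr \<beta> + rate\<^sup>2 * m2 / 2 * s powr (2 * \<beta>) +
          (rate * m1)\<^sup>2 * (s powr \<beta> * (t - s) powr \<beta>))
        \<le> (\<integral>\<^sup>+\<omega>. ennreal (real (X s \<omega>) * real (X t \<omega>)) \<partial>M)"
      unfolding product[OF st(1) less_imp_le[OF st(2)]]
      using E_product_moment_bounds(1)[OF st]
      by (subst split) (auto intro!: add_left_mono mult_left_mono)
    show "(\<integral>\<^sup>+\<omega>. ennreal (real (X s \<omega>) * real (X t \<omega>)) \<partial>M)
        \<le> ennreal (rate * m1 * s powr \<beta> + rate\<^sup>2 * m2 / 2 * s powr (2 * \<beta>) +
          (rate * m1)\<^sup>2 * (s powr \<beta> * t powr \<beta>))"
      unfolding product[OF st(1) less_imp_le[OF st(2)]]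
      using E_product_moment_bounds(2)[OF st]
      by (subst split) (auto intro!: add_left_mono mult_left_mono)
  qed
qed

section \<open>Quotients of Gamma values\<close>

text \<open>
  Logarithmic convexity between \<open>x\<close> and \<open>x + 1\<close>.
\<close>

lemma Gamma_shift_upper:
  assumes x: "0 < x" and c: "0 < c" "c < (1::real)"
  shows "Gamma (x + c) \<le> Gamma x * x powr c"
proof -
  have "(ln \<circ> Gamma) ((1 - c) *\<^sub>R x + c *\<^sub>R (x + 1)) \<le> (1 - c) * (ln \<circ> Gamma) x + c * (ln \<circ> Gamma) (x + 1)"
    by (rule convex_onD[OF log_convex_Gamma_real]) (use x c in auto)
  moreover have "(1 - c) *\<^sub>R x + c *\<^sub>R (x + 1) = x + c"
    by (simp add: algebra_simps)
  moreover have "Gamma (x + 1) = x * Gamma x"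
    using x by (intro Gamma_plus1) auto
  ultimately have "ln (Gamma (x + c)) \<le> ln (Gamma x) + c * ln x"
    using x Gamma_real_pos[OF x] by (simp add: ln_mult_pos algebra_simps)
  then have "exp (ln (Gamma (x + c))) \<le> exp (ln (Gamma x) + c * ln x)"
    by simp
  then show ?thesis
    using x c by (simp add: exp_add powr_def Gamma_real_pos)
qed

text \<open>
  The upper bound, applied from \<open>x + c\<close> to \<open>x + 1\<close>.
\<close>

lemma Gamma_shift_lower:
  assumes x: "0 < x" and c: "0 < c" "c < (1::real)"
  shows "Gamma x * x \<le> Gamma (x + c) * (x + c) powr (1 - c)"
proof -
  have "Gamma (x + 1) = x * Gamma x"
    using x by (intro Gamma_plus1) auto
  then show ?thesis
    using Gamma_shift_upper[of "x + c" "1 - c"] x c by (simp add: mult.commute)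
qed

lemma Gamma_shift_asymptotics:
  assumes c: "0 < c" "c < (1::real)"
  shows "((\<lambda>x. Gamma (x + c) / Gamma x / x powr c) \<longlongrightarrow> 1) at_top"
proof (rule tendsto_sandwich)
  show "((\<lambda>x. x powr (1 - c) / (x + c) powr (1 - c)) \<longlongrightarrow> 1) at_top"
    using c by real_asymp
  show "((\<lambda>_. 1) \<longlongrightarrow> (1::real)) at_top"
    by simp
  show "eventually (\<lambda>x. x powr (1 - c) / (x + c) powr (1 - c) \<le> Gamma (x + c) / Gamma x / x powr c) at_top"
    using eventually_gt_at_top[of 0]
  proof eventually_elim
    case (elim x)
    have "x powr (1 - c) * x powr c = x"
      using elim by (simp add: powr_add[symmetric])
    then show ?case
      using Gamma_shift_lower[OF elim c] elim c Gamma_real_pos[OF elim]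
      by (simp add: divide_simps) (simp add: algebra_simps)
  qed
  show "eventually (\<lambda>x. Gamma (x + c) / Gamma x / x powr c \<le> 1) at_top"
    using eventually_gt_at_top[of 0]
  proof eventually_elim
    case (elim x)
    then show ?case
      using Gamma_shift_upper[OF elim c] Gamma_real_pos[OF elim]
      by (simp add: divide_simps mult.commute)
  qed
qed

text \<open>
  The exponent \<open>2 * c\<close> may exceed 1, beyond the reach of convexity between
  \<open>x\<close> and \<open>x + 1\<close>, so the shift is made in two steps.
\<close>

lemma Gamma_double_shift_asymptotics:
  assumes c: "0 < c" "c < (1::real)"
  shows "((\<lambda>x. Gamma (x + 2 * c) / Gamma x / x powr (2 * c)) \<longlongrightarrow> 1) at_top"
proof -
  have "((\<lambda>x. Gamma (x + c + c) / Gamma (x + c) / (x + c) powr c) \<longlongrightarrow> 1) at_top"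
    by (rule filterlim_compose[OF Gamma_shift_asymptotics[OF c]]) real_asymp
  moreover have "((\<lambda>x. (x + c) powr c / x powr c) \<longlongrightarrow> 1) at_top"
    using c by real_asymp
  ultimately have "((\<lambda>x. (Gamma (x + c + c) / Gamma (x + c) / (x + c) powr c) * ((x + c) powr c / x powr c)
      * (Gamma (x + c) / Gamma x / x powr c)) \<longlongrightarrow> 1 * 1 * 1) at_top"
    using Gamma_shift_asymptotics[OF c] by (intro tendsto_mult)
  moreover have "eventually (\<lambda>x. (Gamma (x + c + c) / Gamma (x + c) / (x + c) powr c) * ((x + c) powr c / x powr c)
      * (Gamma (x + c) / Gamma x / x powr c) = Gamma (x + 2 * c) / Gamma x / x powr (2 * c)) at_top"
    using eventually_gt_at_top[of 0]
  proof eventually_elim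
    case (elim x)
    then have "0 < Gamma (x + c)" "0 < (x + c) powr c"
      using c by (simp_all add: Gamma_real_pos)
    then have "Gamma (x + c + c) / Gamma (x + c) / (x + c) powr c * ((x + c) powr c / x powr c) *
        (Gamma (x + c) / Gamma x / x powr c) = Gamma (x + c + c) / Gamma x / (x powr c * x powr c)"
      by simp
    then show ?case
      by (simp add: powr_add[symmetric] add.assoc flip: mult_2)
  qed
  ultimately have "((\<lambda>x. Gamma (x + 2 * c) / Gamma x / x powr (2 * c)) \<longlongrightarrow> 1 * 1 * 1) at_top"
    by (rule Lim_transform_eventually)
  then show ?thesis
    by simp
qed

lemma Gamma_negative_shift_limit:
  assumes c: "0 < c" "c < (1::real)"
  shows "((\<lambda>x. Gamma (x + (c - 1)) / Gamma x) \<longlongrightarrow> 0) at_top"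
proof (rule tendsto_sandwich[where f = "\<lambda>_. 0" and h = "\<lambda>x. x powr c / (x + (c - 1))"])
  show "((\<lambda>x. x powr c / (x + (c - 1))) \<longlongrightarrow> 0) at_top"
    using c by real_asymp
  show "eventually (\<lambda>x. 0 \<le> Gamma (x + (c - 1)) / Gamma x) at_top"
    using eventually_gt_at_top[of 1] by eventually_elim (use c in \<open>simp add: Gamma_real_nonneg\<close>)
  show "eventually (\<lambda>x. Gamma (x + (c - 1)) / Gamma x \<le> x powr c / (x + (c - 1))) at_top"
    using eventually_gt_at_top[of 1]
  proof eventually_elim
    case (elim x)
    then have pos: "0 < x" "0 < x + (c - 1)"
      using c by auto
    have "x + (c - 1) \<notin> \<int>\<^sub>\<le>\<^sub>0"
      using pos(2) by auto
    then have "Gamma (x + (c - 1)) * (x + (c - 1)) = Gamma (x + c)"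
      using Gamma_plus1[of "x + (c - 1)"] by (simp add: mult.commute)
    then show ?case
      using Gamma_shift_upper[OF pos(1) c] pos Gamma_real_pos[OF pos(1)]
      by (simp add: divide_simps) (simp add: mult.commute)
  qed
qed simp

text \<open>
  The moment of order \<open>c\<close> of the gamma law with shape \<open>p * t\<close> and
  inverse scale \<open>\<alpha>\<close>; negative orders above \<open>- p * t\<close> are
  included.
\<close>

definition gamma_moment :: "real \<Rightarrow> real \<Rightarrow> real \<Rightarrow> real \<Rightarrow> real" where
  "gamma_moment \<alpha> p c t = Gamma (p * t + c) / (Gamma (p * t) * \<alpha> powr c)"

lemma gamma_moment_pos:
  assumes "0 < \<alpha>" "0 < p * t" "0 < p * t + c"
  shows "0 < gamma_moment \<alpha> p c t"
  using assms by (simp add: gamma_moment_def Gamma_real_pos)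

lemma gamma_moment_asymptotics:
  assumes \<alpha>: "0 < \<alpha>" and p: "0 < p" and c: "0 < c" "c < 1"
  shows "((\<lambda>t. gamma_moment \<alpha> p c t / t powr c) \<longlongrightarrow> (p / \<alpha>) powr c) at_top"
    and "((\<lambda>t. gamma_moment \<alpha> p (2 * c) t / t powr (2 * c)) \<longlongrightarrow> (p / \<alpha>) powr (2 * c)) at_top"
    and "((\<lambda>t. gamma_moment \<alpha> p (c - 1) t) \<longlongrightarrow> 0) at_top"
proof -
  have pt: "filterlim (\<lambda>t. p * t) at_top at_top"
    using p by real_asymp
  have rescale: "((\<lambda>t. gamma_moment \<alpha> p d t / t powr d) \<longlongrightarrow> (p / \<alpha>) powr d) at_top"
    if "((\<lambda>x. Gamma (x + d) / Gamma x / x powr d) \<longlongrightarrow> 1) at_top" for d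
  proof -
    have "((\<lambda>t. Gamma (p * t + d) / Gamma (p * t) / (p * t) powr d * (p / \<alpha>) powr d)
        \<longlongrightarrow> 1 * (p / \<alpha>) powr d) at_top"
      by (intro tendsto_mult tendsto_const filterlim_compose[OF that pt])
    moreover have "eventually (\<lambda>t. Gamma (p * t + d) / Gamma (p * t) / (p * t) powr d * (p / \<alpha>) powr d
        = gamma_moment \<alpha> p d t / t powr d) at_top"
      using eventually_gt_at_top[of 0]
      by eventually_elim (use p \<alpha> in \<open>simp add: gamma_moment_def powr_mult powr_divide\<close>)
    ultimately have "((\<lambda>t. gamma_moment \<alpha> p d t / t powr d) \<longlongrightarrow> 1 * (p / \<alpha>) powr d) at_top"
      by (rule Lim_transform_eventually)
    then show ?thesis
      by simp
  qed
  show "((\<lambda>t. gamma_moment \<alpha> p c t / t powr c) \<longlongrightarrow> (p / \<alpha>) powr c) at_top"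
    by (rule rescale) (rule Gamma_shift_asymptotics[OF c])
  show "((\<lambda>t. gamma_moment \<alpha> p (2 * c) t / t powr (2 * c)) \<longlongrightarrow> (p / \<alpha>) powr (2 * c)) at_top"
    by (rule rescale) (rule Gamma_double_shift_asymptotics[OF c])
  have "((\<lambda>t. Gamma (p * t + (c - 1)) / Gamma (p * t) / \<alpha> powr (c - 1)) \<longlongrightarrow> 0 / \<alpha> powr (c - 1)) at_top"
    using \<alpha> by (intro tendsto_divide tendsto_const filterlim_compose[OF Gamma_negative_shift_limit[OF c] pt]) auto
  then show "((\<lambda>t. gamma_moment \<alpha> p (c - 1) t) \<longlongrightarrow> 0) at_top"
    by (simp add: gamma_moment_def divide_divide_eq_left)
qed

section \<open>Power moments of the gamma subordinator\<close>

text \<open>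
  With \<open>d = b - a\<close>, Bernoulli's inequality \<open>(1 + a / d) powr c \<le> 1 + a /
  d\<close>. The point is that \<open>a\<close> and \<open>b - a\<close>, unlike \<open>a\<close>
  and \<open>b\<close>, become independent for the gamma process.
\<close>

lemma powr_increment_bound:
  assumes "0 < a" "a < b" and c: "0 < c" "c < (1::real)"
  shows "b powr c \<le> (b - a) powr c + a * (b - a) powr (c - 1)"
proof -
  define d where "d = b - a"
  have d: "0 < d" "b = d * (1 + a / d)"
    using assms by (auto simp: d_def field_simps)
  have "b powr c = d powr c * (1 + a / d) powr c"
    unfolding d(2) using d(1) assms by (subst powr_mult) auto
  also have "\<dots> \<le> d powr c * (1 + a / d) powr 1"
    using d(1) assms by (intro mult_left_mono powr_mono) auto
  also have "\<dots> = d powr c + a * (d powr c / d)"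
    using d(1) assms by (simp add: algebra_simps)
  also have "d powr c / d = d powr (c - 1)"
    using d(1) by (simp add: powr_diff)
  finally show ?thesis
    by (simp add: d_def)
qed

locale gamma_process = prob_space M for M :: "'a measure" +
  fixes \<alpha> p :: real and Y :: "real \<Rightarrow> 'a \<Rightarrow> real"
  assumes \<alpha>: "0 < \<alpha>" and p: "0 < p" and Y: "gamma_subordinator \<alpha> p M Y"
begin

lemma Y_subordinator: "subordinator M Y"
  using Y by (simp add: gamma_subordinator_def)

lemma Y_measurable: "0 \<le> t \<Longrightarrow> Y t \<in> borel_measurable M"
  using Y_subordinator by (simp add: subordinator_def process_def)

lemma Y_distributed: "0 < t \<Longrightarrow> distributed M lborel (Y t) (\<lambda>y. ennreal (gamma_density \<alpha> (p * t) y))"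
  using Y by (simp add: gamma_subordinator_def)

text \<open>
  Every shape \<open>b > 0\<close> occurs as the law of \<open>Y (b / p)\<close>, so each of these
  densities has total mass 1.
\<close>

lemma nn_integral_gamma_density:
  assumes "0 < b"
  shows "(\<integral>\<^sup>+y. ennreal (gamma_density \<alpha> b y) \<partial>lborel) = 1"
proof -
  have "distributed M lborel (Y (b / p)) (\<lambda>y. ennreal (gamma_density \<alpha> b y))"
    using Y_distributed[of "b / p"] assms p by simp
  from distributed_nn_integral[OF this, of "\<lambda>_. 1"] show ?thesis
    by (simp add: emeasure_space_1)
qed

lemma Y_pos:
  assumes "0 < t"
  shows "AE \<omega> in M. 0 < Y t \<omega>"
proof -
  note [measurable] = Y_measurable[OF less_imp_le[OF assms]]
  have "(\<integral>\<^sup>+\<omega>. indicator {..0} (Y t \<omega>) \<partial>M) =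
      (\<integral>\<^sup>+y. ennreal (gamma_density \<alpha> (p * t) y) * indicator {..0} y \<partial>lborel)"
    by (rule distributed_nn_integral[OF Y_distributed[OF assms], symmetric]) simp
  also have "\<dots> = (\<integral>\<^sup>+(y::real). 0 \<partial>lborel)"
    by (rule nn_integral_cong) (simp add: gamma_density_def split: split_indicator)
  finally have "AE \<omega> in M. indicator {..0} (Y t \<omega>) = (0::ennreal)"
    by (simp add: nn_integral_0_iff_AE)
  then show ?thesis
    by eventually_elim (auto split: split_indicator_asm)
qed

text \<open>
  Multiplying a gamma density by a power yields a multiple of another gamma density.
\<close>

lemma Y_moment:
  assumes t: "0 < t" and c: "0 < p * t + c"
  shows "(\<integral>\<^sup>+\<omega>. ennreal (Y t \<omega> powr c) \<partial>M) = ennreal (gamma_moment \<alpha> p c t)"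
proof -
  have pt: "0 < p * t" using p t by simp
  have "(\<integral>\<^sup>+\<omega>. ennreal (Y t \<omega> powr c) \<partial>M) =
      (\<integral>\<^sup>+y. ennreal (gamma_density \<alpha> (p * t) y) * ennreal (y powr c) \<partial>lborel)"
    by (rule distributed_nn_integral[OF Y_distributed[OF t], symmetric]) simp
  also have "\<dots> = (\<integral>\<^sup>+y. ennreal (gamma_moment \<alpha> p c t) * ennreal (gamma_density \<alpha> (p * t + c) y) \<partial>lborel)"
  proof (rule nn_integral_cong)
    fix y
    have "gamma_density \<alpha> (p * t) y * y powr c = gamma_moment \<alpha> p c t * gamma_density \<alpha> (p * t + c) y"
    proof (cases "0 < y")
      case True
      have "y powr (p * t + c - 1) = y powr (p * t - 1) * y powr c"
        by (simp add: powr_add[symmetric] algebra_simps)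
      moreover have "\<alpha> powr (p * t + c) = \<alpha> powr (p * t) * \<alpha> powr c"
        by (rule powr_add)
      moreover have "0 < Gamma (p * t + c)" "0 < \<alpha> powr c"
        using c \<alpha> by (simp_all add: Gamma_real_pos)
      ultimately show ?thesis
        using True by (simp add: gamma_density_def gamma_moment_def)
    qed (simp add: gamma_density_def)
    then show "ennreal (gamma_density \<alpha> (p * t) y) * ennreal (y powr c) =
        ennreal (gamma_moment \<alpha> p c t) * ennreal (gamma_density \<alpha> (p * t + c) y)"
      using gamma_moment_pos[OF \<alpha> pt c] by (simp add: ennreal_mult'[symmetric] ennreal_mult''[symmetric])
  qed
  also have "\<dots> = ennreal (gamma_moment \<alpha> p c t) * (\<integral>\<^sup>+y. ennreal (gamma_density \<alpha> (p * t + c) y) \<partial>lborel)"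
    by (rule nn_integral_cmult) (simp add: gamma_density_def[abs_def])
  finally show ?thesis
    by (simp add: nn_integral_gamma_density[OF c])
qed

lemma Y_increment_nn_integral:
  fixes f :: "real \<Rightarrow> ennreal"
  assumes st: "0 \<le> s" "s < t" and f [measurable]: "f \<in> borel_measurable borel"
  shows "(\<integral>\<^sup>+\<omega>. f (Y t \<omega> - Y s \<omega>) \<partial>M) = (\<integral>\<^sup>+\<omega>. f (Y (t - s) \<omega>) \<partial>M)"
proof -
  have [measurable]: "Y 0 \<in> borel_measurable M" "Y s \<in> borel_measurable M" "Y t \<in> borel_measurable M"
    "Y (t - s) \<in> borel_measurable M"
    using st by (auto intro: Y_measurable)
  have start: "AE \<omega> in M. Y 0 \<omega> = 0" and stat: "stationary_increments M Y"
    using Y_subordinator by (simp_all add: subordinator_def)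
  have "0 \<le> t - s" using st by simp
  with stat st(1) have "distr M borel (\<lambda>\<omega>. Y (s + (t - s)) \<omega> - Y s \<omega>) = distr M borel (\<lambda>\<omega>. Y (t - s) \<omega> - Y 0 \<omega>)"
    unfolding stationary_increments_def by blast
  then have distr: "distr M borel (\<lambda>\<omega>. Y t \<omega> - Y s \<omega>) = distr M borel (\<lambda>\<omega>. Y (t - s) \<omega> - Y 0 \<omega>)"
    by simp
  have "(\<integral>\<^sup>+\<omega>. f (Y t \<omega> - Y s \<omega>) \<partial>M) = (\<integral>\<^sup>+x. f x \<partial>distr M borel (\<lambda>\<omega>. Y t \<omega> - Y s \<omega>))"
    by (rule nn_integral_distr[symmetric]) auto
  also have "\<dots> = (\<integral>\<^sup>+\<omega>. f (Y (t - s) \<omega> - Y 0 \<omega>) \<partial>M)"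
    unfolding distr by (rule nn_integral_distr) auto
  also have "\<dots> = (\<integral>\<^sup>+\<omega>. f (Y (t - s) \<omega>) \<partial>M)"
    by (rule nn_integral_cong_AE, use start in eventually_elim) simp
  finally show ?thesis .
qed

lemma Y_strict_mono:
  assumes st: "0 < s" "s < t"
  shows "AE \<omega> in M. 0 < Y s \<omega> \<and> Y s \<omega> < Y t \<omega>"
proof -
  have [measurable]: "Y s \<in> borel_measurable M" "Y t \<in> borel_measurable M"
    "Y (t - s) \<in> borel_measurable M"
    using st by (auto intro: Y_measurable)
  have "(\<integral>\<^sup>+\<omega>. indicator {..0} (Y t \<omega> - Y s \<omega>) \<partial>M) = (\<integral>\<^sup>+\<omega>. indicator {..0} (Y (t - s) \<omega>) \<partial>M)"
    using st by (intro Y_increment_nn_integral) auto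
  also have "\<dots> = (\<integral>\<^sup>+\<omega>. 0 \<partial>M)"
    by (rule nn_integral_cong_AE, use Y_pos[of "t - s", simplified, OF st(2)] in eventually_elim) simp
  finally have "AE \<omega> in M. indicator {..0} (Y t \<omega> - Y s \<omega>) = (0::ennreal)"
    by (simp add: nn_integral_0_iff_AE)
  with Y_pos[OF st(1)] show ?thesis
    by eventually_elim (auto split: split_indicator_asm)
qed

lemma Y_mixed_moment:
  assumes st: "0 < s" "s < t" and c: "0 < p * s + c" and d: "0 < p * (t - s) + d"
  shows "(\<integral>\<^sup>+\<omega>. ennreal (Y s \<omega> powr c) * ennreal ((Y t \<omega> - Y s \<omega>) powr d) \<partial>M) =
         ennreal (gamma_moment \<alpha> p c s * gamma_moment \<alpha> p d (t - s))"
proof -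
  have start: "AE \<omega> in M. Y 0 \<omega> = 0" and indep: "independent_increments M Y"
    using Y_subordinator by (simp_all add: subordinator_def)
  have s_increment: "(\<integral>\<^sup>+\<omega>. ennreal ((Y s \<omega> - Y 0 \<omega>) powr c) \<partial>M) = ennreal (gamma_moment \<alpha> p c s)"
    using Y_increment_nn_integral[of 0 s "\<lambda>x. ennreal (x powr c)"] Y_moment[OF st(1) c] st by simp
  have t_increment: "(\<integral>\<^sup>+\<omega>. ennreal ((Y t \<omega> - Y s \<omega>) powr d) \<partial>M) = ennreal (gamma_moment \<alpha> p d (t - s))"
    using Y_increment_nn_integral[of s t "\<lambda>x. ennreal (x powr d)"] Y_moment[of "t - s" d] st d by simp
  have "(\<integral>\<^sup>+\<omega>. ennreal (Y s \<omega> powr c) * ennreal ((Y t \<omega> - Y s \<omega>) powr d) \<partial>M) =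
      (\<integral>\<^sup>+\<omega>. ennreal ((Y s \<omega> - Y 0 \<omega>) powr c) * ennreal ((Y t \<omega> - Y s \<omega>) powr d) \<partial>M)"
    by (rule nn_integral_cong_AE, use start in eventually_elim) simp
  also have "\<dots> = ennreal (gamma_moment \<alpha> p c s) * ennreal (gamma_moment \<alpha> p d (t - s))"
    unfolding s_increment[symmetric] t_increment[symmetric]
    using st by (intro independent_increments_nn_integral[OF prob_space_axioms indep]) auto
  also have "\<dots> = ennreal (gamma_moment \<alpha> p c s * gamma_moment \<alpha> p d (t - s))"
    using gamma_moment_pos[OF \<alpha> _ c] p st by (intro ennreal_mult'[symmetric]) (auto intro: less_imp_le)
  finally show ?thesis .
qed

abbreviation G :: "real \<Rightarrow> real \<Rightarrow> real" where "G \<equiv> gamma_moment \<alpha> p"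

lemma G_pos: "0 < t \<Longrightarrow> 0 < p * t + c \<Longrightarrow> 0 < G c t"
  using \<alpha> p by (intro gamma_moment_pos) auto

text \<open>
  The mean of \<open>Y t powr c\<close> changes over a fixed time lag by at most a multiple of a
  moment of negative order \<open>c - 1\<close>, which tends to 0.
\<close>

lemma G_increment_bounds:
  assumes c: "0 < c" "c < 1" and st: "0 < s" "s < t"
  shows "G c (t - s) \<le> G c t"
    and "0 < p * (t - s) + (c - 1) \<Longrightarrow> G c t \<le> G c (t - s) + G 1 s * G (c - 1) (t - s)"
proof -
  have [measurable]: "Y s \<in> borel_measurable M" "Y t \<in> borel_measurable M"
    using st by (auto intro: Y_measurable)
  have pos: "0 < p * t + c" "0 < p * (t - s) + c" "0 < p * s + 1"
    using p c st by (auto intro!: add_pos_pos)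
  have Gt: "(\<integral>\<^sup>+\<omega>. ennreal (Y t \<omega> powr c) \<partial>M) = ennreal (G c t)"
    using st pos by (intro Y_moment) auto
  have Gst: "(\<integral>\<^sup>+\<omega>. ennreal ((Y t \<omega> - Y s \<omega>) powr c) \<partial>M) = ennreal (G c (t - s))"
    using Y_increment_nn_integral[of s t "\<lambda>x. ennreal (x powr c)"] Y_moment[of "t - s" c] st pos by simp
  have "ennreal (G c (t - s)) \<le> ennreal (G c t)"
    unfolding Gt[symmetric] Gst[symmetric]
    by (rule nn_integral_mono_AE, use Y_strict_mono[OF st] in eventually_elim)
       (use c in \<open>auto intro!: ennreal_leI powr_mono2\<close>)
  then show "G c (t - s) \<le> G c t"
    using G_pos[of t c] st pos by (simp add: ennreal_le_iff)
  assume pos': "0 < p * (t - s) + (c - 1)"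
  have "ennreal (G c t) \<le>
      (\<integral>\<^sup>+\<omega>. ennreal ((Y t \<omega> - Y s \<omega>) powr c) +
        ennreal (Y s \<omega> powr 1) * ennreal ((Y t \<omega> - Y s \<omega>) powr (c - 1)) \<partial>M)"
    unfolding Gt[symmetric]
  proof (rule nn_integral_mono_AE, use Y_strict_mono[OF st] in eventually_elim)
    case (elim \<omega>)
    then have "Y t \<omega> powr c \<le> (Y t \<omega> - Y s \<omega>) powr c + Y s \<omega> powr 1 * (Y t \<omega> - Y s \<omega>) powr (c - 1)"
      using powr_increment_bound[of "Y s \<omega>" "Y t \<omega>" c] c by simp
    then show ?case
      by (simp add: ennreal_mult'[symmetric] ennreal_plus[symmetric] ennreal_leI del: ennreal_plus powr_one)
  qed
  also have "\<dots> = ennreal (G c (t - s)) + ennreal (G 1 s * G (c - 1) (t - s))"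
    using Gst Y_mixed_moment[OF st pos(3) pos'] by (simp add: nn_integral_add)
  also have "\<dots> = ennreal (G c (t - s) + G 1 s * G (c - 1) (t - s))"
    using G_pos[of "t - s" c] G_pos[of s 1] G_pos[of "t - s" "c - 1"] st pos pos'
    by (intro ennreal_plus[symmetric]) auto
  finally show "G c t \<le> G c (t - s) + G 1 s * G (c - 1) (t - s)"
    using G_pos[of "t - s" c] G_pos[of s 1] G_pos[of "t - s" "c - 1"] st pos pos'
    by (subst (asm) ennreal_le_iff) (auto intro: add_nonneg_nonneg)
qed

text \<open>
  Nonnegativity of the variance of \<open>Y t powr c\<close>.
\<close>

lemma G_square_le:
  assumes c: "0 < c" and t: "0 < t"
  shows "(G c t)\<^sup>2 \<le> G (2 * c) t"
proof -
  note [measurable] = Y_measurable[OF less_imp_le[OF t]]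
  have pos: "0 < p * t + c" "0 < p * t + 2 * c"
    using p c t by (auto intro!: add_pos_pos)
  have first: "integrable M (\<lambda>\<omega>. Y t \<omega> powr c) \<and> expectation (\<lambda>\<omega>. Y t \<omega> powr c) = G c t"
    using Y_moment[OF t pos(1)] G_pos[OF t pos(1)] by (subst (asm) nn_integral_eq_integrable) auto
  have sq: "(Y t \<omega> powr c)\<^sup>2 = Y t \<omega> powr (2 * c)" for \<omega>
    by (simp add: power2_eq_square powr_add[symmetric])
  have second: "integrable M (\<lambda>\<omega>. (Y t \<omega> powr c)\<^sup>2) \<and> expectation (\<lambda>\<omega>. (Y t \<omega> powr c)\<^sup>2) = G (2 * c) t"
    unfolding sq
    using Y_moment[OF t pos(2)] G_pos[OF t pos(2)] by (subst (asm) nn_integral_eq_integrable) auto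
  have "0 \<le> variance (\<lambda>\<omega>. Y t \<omega> powr c)"
    by (rule variance_positive)
  also have "\<dots> = G (2 * c) t - (G c t)\<^sup>2"
    using first second by (subst variance_eq) simp_all
  finally show ?thesis by simp
qed

end

section \<open>Correlation decay under a gamma time change\<close>

lemma (in prob_space) covariance_eq:
  assumes "integrable M U" "integrable M V" "integrable M (\<lambda>\<omega>. U \<omega> * V \<omega> :: real)"
  shows "covariance M U V = expectation (\<lambda>\<omega>. U \<omega> * V \<omega>) - expectation U * expectation V"
proof -
  have "covariance M U V = expectation (\<lambda>\<omega>. U \<omega> * V \<omega> - expectation V * U \<omega> - expectation U * V \<omega>
      + expectation U * expectation V)"
    unfolding covariance_def by (rule Bochner_Integration.integral_cong) (simp_all add: algebra_simps)
  also have "\<dots> = expectation (\<lambda>\<omega>. U \<omega> * V \<omega>) - expectation U * expectation V"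
    using assms by (simp add: prob_space)
  finally show ?thesis .
qed

text \<open>
  A process \<open>X\<close> whose moments follow power laws as those of the fractional Poisson
  process do, and its time change \<open>Q\<close> by the gamma process, given through the
  conditioning formula for functions of two of its values.
\<close>

locale gamma_time_change = gamma_process M \<alpha> p Y
  for M :: "'a measure" and \<alpha> p :: real and Y :: "real \<Rightarrow> 'a \<Rightarrow> real" +
  fixes \<beta> A B :: real and X Q :: "real \<Rightarrow> 'a \<Rightarrow> nat"
  assumes \<beta>: "0 < \<beta>" "\<beta> < 1" and A: "0 \<le> A" and AB: "A\<^sup>2 < B"
    and Q_measurable: "\<And>t. 0 \<le> t \<Longrightarrow> Q t \<in> measurable M (count_space UNIV)"
    and Q_moment: "\<And>s t h. 0 < s \<Longrightarrow> 0 < t \<Longrightarrow> (\<integral>\<^sup>+\<omega>. h (Q s \<omega>) (Q t \<omega>) \<partial>M) =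
           (\<integral>\<^sup>+\<omega>. (\<integral>\<^sup>+\<omega>'. h (X (Y s \<omega>) \<omega>') (X (Y t \<omega>) \<omega>') \<partial>M) \<partial>M)"
    and X_mean: "\<And>t. 0 < t \<Longrightarrow> (\<integral>\<^sup>+\<omega>. ennreal (real (X t \<omega>)) \<partial>M) = ennreal (A * t powr \<beta>)"
    and X_second: "\<And>t. 0 < t \<Longrightarrow> (\<integral>\<^sup>+\<omega>. ennreal ((real (X t \<omega>))\<^sup>2) \<partial>M) =
           ennreal (A * t powr \<beta> + B * t powr (2 * \<beta>))"
    and X_lower: "\<And>s t. 0 < s \<Longrightarrow> s < t \<Longrightarrow>
           ennreal (A * s powr \<beta> + B / 2 * s powr (2 * \<beta>) + A\<^sup>2 * (s powr \<beta> * (t - s) powr \<beta>))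
           \<le> (\<integral>\<^sup>+\<omega>. ennreal (real (X s \<omega>) * real (X t \<omega>)) \<partial>M)"
    and X_upper: "\<And>s t. 0 < s \<Longrightarrow> s < t \<Longrightarrow>
           (\<integral>\<^sup>+\<omega>. ennreal (real (X s \<omega>) * real (X t \<omega>)) \<partial>M)
           \<le> ennreal (A * s powr \<beta> + B / 2 * s powr (2 * \<beta>) + A\<^sup>2 * (s powr \<beta> * t powr \<beta>))"
begin

lemma B_pos: "0 < B"
  using AB by (smt (verit) zero_le_power2)

lemma moment_positivity:
  assumes "0 < t"
  shows "0 < p * t" "0 < p * t + \<beta>" "0 < p * t + 2 * \<beta>" "0 < p * t + (\<beta> + 1)"
  using assms p \<beta> by (auto intro!: add_pos_pos)

lemma Q_mean:
  assumes t: "0 < t"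
  shows "integrable M (\<lambda>\<omega>. real (Q t \<omega>))" "expectation (\<lambda>\<omega>. real (Q t \<omega>)) = A * G \<beta> t"
proof -
  note [measurable] = Y_measurable[OF less_imp_le[OF t]] Q_measurable[OF less_imp_le[OF t]]
  note pos = moment_positivity[OF t]
  have "(\<integral>\<^sup>+\<omega>. ennreal (real (Q t \<omega>)) \<partial>M) = (\<integral>\<^sup>+\<omega>. ennreal A * ennreal (Y t \<omega> powr \<beta>) \<partial>M)"
    unfolding Q_moment[OF t t, of "\<lambda>i _. ennreal (real i)"]
    by (rule nn_integral_cong_AE, use Y_pos[OF t] in eventually_elim)
       (use A in \<open>simp add: X_mean ennreal_mult'\<close>)
  also have "\<dots> = ennreal A * ennreal (G \<beta> t)"
    unfolding Y_moment[OF t pos(2), symmetric] by (rule nn_integral_cmult) measurable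
  also have "\<dots> = ennreal (A * G \<beta> t)"
    using A by (simp add: ennreal_mult')
  finally have "integrable M (\<lambda>\<omega>. real (Q t \<omega>)) \<and> expectation (\<lambda>\<omega>. real (Q t \<omega>)) = A * G \<beta> t"
    using A G_pos[OF t pos(2)] by (subst (asm) nn_integral_eq_integrable) auto
  then show "integrable M (\<lambda>\<omega>. real (Q t \<omega>))" "expectation (\<lambda>\<omega>. real (Q t \<omega>)) = A * G \<beta> t"
    by simp_all
qed

lemma Q_second_moment:
  assumes t: "0 < t"
  shows "integrable M (\<lambda>\<omega>. (real (Q t \<omega>))\<^sup>2)"
    and "expectation (\<lambda>\<omega>. (real (Q t \<omega>))\<^sup>2) = A * G \<beta> t + B * G (2 * \<beta>) t"
proof -
  note [measurable] = Y_measurable[OF less_imp_le[OF t]] Q_measurable[OF less_imp_le[OF t]]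
  note pos = moment_positivity[OF t]
  have "(\<integral>\<^sup>+\<omega>. ennreal ((real (Q t \<omega>))\<^sup>2) \<partial>M) =
      (\<integral>\<^sup>+\<omega>. ennreal A * ennreal (Y t \<omega> powr \<beta>) + ennreal B * ennreal (Y t \<omega> powr (2 * \<beta>)) \<partial>M)"
    unfolding Q_moment[OF t t, of "\<lambda>i _. ennreal ((real i)\<^sup>2)"]
    by (rule nn_integral_cong_AE, use Y_pos[OF t] in eventually_elim)
       (use A B_pos in \<open>simp add: X_second ennreal_mult' ennreal_plus\<close>)
  also have "\<dots> = ennreal A * ennreal (G \<beta> t) + ennreal B * ennreal (G (2 * \<beta>) t)"
    unfolding Y_moment[OF t pos(2), symmetric] Y_moment[OF t pos(3), symmetric]
    by (simp add: nn_integral_add nn_integral_cmult)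
  also have "\<dots> = ennreal (A * G \<beta> t + B * G (2 * \<beta>) t)"
    using A B_pos G_pos[OF t pos(2)] G_pos[OF t pos(3)] by (simp add: ennreal_mult' ennreal_plus)
  finally have "integrable M (\<lambda>\<omega>. (real (Q t \<omega>))\<^sup>2) \<and>
      expectation (\<lambda>\<omega>. (real (Q t \<omega>))\<^sup>2) = A * G \<beta> t + B * G (2 * \<beta>) t"
    using A B_pos G_pos[OF t pos(2)] G_pos[OF t pos(3)]
    by (subst (asm) nn_integral_eq_integrable) auto
  then show "integrable M (\<lambda>\<omega>. (real (Q t \<omega>))\<^sup>2)"
    "expectation (\<lambda>\<omega>. (real (Q t \<omega>))\<^sup>2) = A * G \<beta> t + B * G (2 * \<beta>) t"
    by simp_all
qed

lemma Q_variance: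
  assumes t: "0 < t"
  shows "variance (\<lambda>\<omega>. real (Q t \<omega>)) = A * G \<beta> t + B * G (2 * \<beta>) t - A\<^sup>2 * (G \<beta> t)\<^sup>2"
  by (subst variance_eq[OF Q_mean(1)[OF t] Q_second_moment(1)[OF t]])
     (simp add: Q_mean(2)[OF t] Q_second_moment(2)[OF t] power_mult_distrib)

lemma Q_variance_pos:
  assumes t: "0 < t"
  shows "0 < variance (\<lambda>\<omega>. real (Q t \<omega>))"
proof -
  note pos = moment_positivity[OF t]
  have "A\<^sup>2 * (G \<beta> t)\<^sup>2 \<le> A\<^sup>2 * G (2 * \<beta>) t"
    using G_square_le[OF \<beta>(1) t] by (intro mult_left_mono) auto
  also have "\<dots> < B * G (2 * \<beta>) t"
    using AB G_pos[OF t pos(3)] by (intro mult_strict_right_mono)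
  finally show ?thesis
    using A G_pos[OF t pos(2)] mult_nonneg_nonneg[of A "G \<beta> t"] unfolding Q_variance[OF t] by linarith
qed

lemma Q_product_integrable:
  assumes "0 < s" "0 < t"
  shows "integrable M (\<lambda>\<omega>. real (Q s \<omega>) * real (Q t \<omega>))"
proof (rule Bochner_Integration.integrable_bound)
  show "integrable M (\<lambda>\<omega>. (real (Q s \<omega>))\<^sup>2 + (real (Q t \<omega>))\<^sup>2)"
    using Q_second_moment(1) assms by simp
  have [measurable]: "Q s \<in> measurable M (count_space UNIV)" "Q t \<in> measurable M (count_space UNIV)"
    using assms by (auto intro: Q_measurable)
  show "(\<lambda>\<omega>. real (Q s \<omega>) * real (Q t \<omega>)) \<in> borel_measurable M"
    by measurable
  have "x * y \<le> x\<^sup>2 + y\<^sup>2" if "0 \<le> x" "0 \<le> y" for x y :: real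
    using sum_squares_bound[of x y] mult_nonneg_nonneg[OF that] by linarith
  then show "AE \<omega> in M. norm (real (Q s \<omega>) * real (Q t \<omega>)) \<le> norm ((real (Q s \<omega>))\<^sup>2 + (real (Q t \<omega>))\<^sup>2)"
    by simp
qed

text \<open>
  Integrating the bounds for \<open>X\<close> at the times \<open>a = Y s\<close> and \<open>b = Y
  t\<close>. The common part \<open>l\<close> is a combination of functions of the independent
  variables \<open>a\<close> and \<open>b - a\<close>, and so is the error \<open>e\<close>
  obtained by splitting \<open>b powr \<beta>\<close>.
\<close>

lemma Q_product_moment:
  assumes st: "0 < s" "s < t"
  shows "A * G \<beta> s + B / 2 * G (2 * \<beta>) s + A\<^sup>2 * (G \<beta> s * G \<beta> (t - s)) \<le>
           expectation (\<lambda>\<omega>. real (Q s \<omega>) * real (Q t \<omega>))"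
    and "0 < p * (t - s) + (\<beta> - 1) \<Longrightarrow>
         expectation (\<lambda>\<omega>. real (Q s \<omega>) * real (Q t \<omega>)) \<le>
           A * G \<beta> s + B / 2 * G (2 * \<beta>) s + A\<^sup>2 * (G \<beta> s * G \<beta> (t - s)) +
           A\<^sup>2 * (G (\<beta> + 1) s * G (\<beta> - 1) (t - s))"
proof -
  have ts: "0 < t" "0 < t - s" using st by simp_all
  note s_pos = moment_positivity[OF st(1)] and ts_pos = moment_positivity[OF ts(2)]
  have [measurable]: "Y s \<in> borel_measurable M" "Y t \<in> borel_measurable M"
    using st by (auto intro: Y_measurable)
  define P where "P = expectation (\<lambda>\<omega>. real (Q s \<omega>) * real (Q t \<omega>))"
  have P: "(\<integral>\<^sup>+\<omega>. ennreal (real (Q s \<omega>) * real (Q t \<omega>)) \<partial>M) = ennreal P"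
    unfolding P_def using Q_product_integrable[OF st(1) ts(1)] by (intro nn_integral_eq_integral) auto
  have P_nonneg: "0 \<le> P"
    unfolding P_def by simp
  define l where "l \<omega> = ennreal A * ennreal (Y s \<omega> powr \<beta>) + ennreal (B / 2) * ennreal (Y s \<omega> powr (2 * \<beta>)) +
      ennreal (A\<^sup>2) * (ennreal (Y s \<omega> powr \<beta>) * ennreal ((Y t \<omega> - Y s \<omega>) powr \<beta>))" for \<omega>
  define e where "e \<omega> = ennreal (A\<^sup>2) *
      (ennreal (Y s \<omega> powr (\<beta> + 1)) * ennreal ((Y t \<omega> - Y s \<omega>) powr (\<beta> - 1)))" for \<omega>
  have [measurable]: "l \<in> borel_measurable M" "e \<in> borel_measurable M"
    unfolding l_def e_def by measurable
  define K where "K = A * G \<beta> s + B / 2 * G (2 * \<beta>) s + A\<^sup>2 * (G \<beta> s * G \<beta> (t - s))"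
  have K_nonneg: "0 \<le> K"
    unfolding K_def using A B_pos G_pos[OF st(1)] G_pos[OF ts(2)] s_pos ts_pos
    by (intro add_nonneg_nonneg mult_nonneg_nonneg) (auto intro: less_imp_le)
  have "integral\<^sup>N M l = ennreal A * ennreal (G \<beta> s) + ennreal (B / 2) * ennreal (G (2 * \<beta>) s) +
      ennreal (A\<^sup>2) * ennreal (G \<beta> s * G \<beta> (t - s))"
    unfolding l_def Y_moment[OF st(1) s_pos(2), symmetric] Y_moment[OF st(1) s_pos(3), symmetric]
      Y_mixed_moment[OF st s_pos(2) ts_pos(2), symmetric]
    by (simp add: nn_integral_add nn_integral_cmult)
  also have "\<dots> = ennreal K"
    unfolding K_def using A B_pos G_pos[OF st(1) s_pos(2)] G_pos[OF st(1) s_pos(3)] G_pos[OF ts(2) ts_pos(2)]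
    by (simp add: ennreal_mult'[symmetric] ennreal_plus[symmetric] del: ennreal_plus)
  finally have l: "integral\<^sup>N M l = ennreal K" .
  have inner: "AE \<omega> in M. l \<omega> \<le> (\<integral>\<^sup>+\<omega>'. ennreal (real (X (Y s \<omega>) \<omega>') * real (X (Y t \<omega>) \<omega>')) \<partial>M) \<and>
      (\<integral>\<^sup>+\<omega>'. ennreal (real (X (Y s \<omega>) \<omega>') * real (X (Y t \<omega>) \<omega>')) \<partial>M) \<le> l \<omega> + e \<omega>"
    using Y_strict_mono[OF st]
  proof eventually_elim
    case (elim \<omega>)
    define a b where "a = Y s \<omega>" and "b = Y t \<omega>"
    have ab: "0 < a" "a < b"
      using elim by (auto simp: a_def b_def)
    have l_eq: "l \<omega> = ennreal (A * a powr \<beta> + B / 2 * a powr (2 * \<beta>) + A\<^sup>2 * (a powr \<beta> * (b - a) powr \<beta>))"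
      using A B_pos
      by (simp add: l_def a_def b_def ennreal_mult'[symmetric] ennreal_plus[symmetric] del: ennreal_plus)
    have e_eq: "e \<omega> = ennreal (A\<^sup>2 * (a powr (\<beta> + 1) * (b - a) powr (\<beta> - 1)))"
      by (simp add: e_def a_def b_def ennreal_mult')
    have "a powr \<beta> * b powr \<beta> \<le> a powr \<beta> * ((b - a) powr \<beta> + a * (b - a) powr (\<beta> - 1))"
      using powr_increment_bound[OF ab \<beta>] by (intro mult_left_mono) auto
    also have "\<dots> = a powr \<beta> * (b - a) powr \<beta> + a powr (\<beta> + 1) * (b - a) powr (\<beta> - 1)"
      using ab by (simp add: powr_add algebra_simps)
    finally have "A\<^sup>2 * (a powr \<beta> * b powr \<beta>) \<le>
        A\<^sup>2 * (a powr \<beta> * (b - a) powr \<beta> + a powr (\<beta> + 1) * (b - a) powr (\<beta> - 1))"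
      by (intro mult_left_mono) auto
    then have "ennreal (A * a powr \<beta> + B / 2 * a powr (2 * \<beta>) + A\<^sup>2 * (a powr \<beta> * b powr \<beta>)) \<le>
        ennreal (A * a powr \<beta> + B / 2 * a powr (2 * \<beta>) + A\<^sup>2 * (a powr \<beta> * (b - a) powr \<beta>) +
          A\<^sup>2 * (a powr (\<beta> + 1) * (b - a) powr (\<beta> - 1)))"
      by (intro ennreal_leI) (simp add: distrib_left)
    also have "\<dots> = l \<omega> + e \<omega>"
      unfolding l_eq e_eq using A B_pos by (intro ennreal_plus add_nonneg_nonneg) auto
    finally show ?case
      using X_lower[OF ab] X_upper[OF ab] unfolding l_eq a_def b_def by (auto intro: order_trans)
  qed
  have "ennreal K \<le> ennreal P"
    unfolding l[symmetric] P[symmetric] Q_moment[OF st(1) ts(1), of "\<lambda>i j. ennreal (real i * real j)"]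
    by (rule nn_integral_mono_AE, use inner in eventually_elim) simp
  then show "A * G \<beta> s + B / 2 * G (2 * \<beta>) s + A\<^sup>2 * (G \<beta> s * G \<beta> (t - s)) \<le>
      expectation (\<lambda>\<omega>. real (Q s \<omega>) * real (Q t \<omega>))"
    using P_nonneg by (simp add: ennreal_le_iff K_def P_def)
  assume neg: "0 < p * (t - s) + (\<beta> - 1)"
  define R where "R = A\<^sup>2 * (G (\<beta> + 1) s * G (\<beta> - 1) (t - s))"
  have R_nonneg: "0 \<le> R"
    unfolding R_def using G_pos[OF st(1) s_pos(4)] G_pos[OF ts(2) neg] by simp
  have "integral\<^sup>N M e = ennreal (A\<^sup>2) * ennreal (G (\<beta> + 1) s * G (\<beta> - 1) (t - s))"
    unfolding e_def Y_mixed_moment[OF st s_pos(4) neg, symmetric]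
    by (rule nn_integral_cmult) measurable
  then have e: "integral\<^sup>N M e = ennreal R"
    by (simp add: R_def ennreal_mult')
  have "ennreal P \<le> (\<integral>\<^sup>+\<omega>. l \<omega> + e \<omega> \<partial>M)"
    unfolding P[symmetric] Q_moment[OF st(1) ts(1), of "\<lambda>i j. ennreal (real i * real j)"]
    by (rule nn_integral_mono_AE, use inner in eventually_elim) simp
  also have "\<dots> = ennreal (K + R)"
    using K_nonneg R_nonneg by (simp add: nn_integral_add l e)
  finally have "P \<le> K + R"
    using K_nonneg R_nonneg by (subst (asm) ennreal_le_iff) auto
  then show "expectation (\<lambda>\<omega>. real (Q s \<omega>) * real (Q t \<omega>)) \<le>
      A * G \<beta> s + B / 2 * G (2 * \<beta>) s + A\<^sup>2 * (G \<beta> s * G \<beta> (t - s)) +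
      A\<^sup>2 * (G (\<beta> + 1) s * G (\<beta> - 1) (t - s))"
    by (simp add: K_def P_def R_def)
qed

lemma Q_covariance:
  assumes "0 < s" "0 < t"
  shows "covariance M (\<lambda>\<omega>. real (Q s \<omega>)) (\<lambda>\<omega>. real (Q t \<omega>)) =
         expectation (\<lambda>\<omega>. real (Q s \<omega>) * real (Q t \<omega>)) - A\<^sup>2 * (G \<beta> s * G \<beta> t)"
  using covariance_eq[OF Q_mean(1)[OF assms(1)] Q_mean(1)[OF assms(2)] Q_product_integrable[OF assms]]
  by (simp add: Q_mean(2) assms power2_eq_square mult_ac)

text \<open>
  The product \<open>A\<^sup>2 G \<beta> s G \<beta> (t - s)\<close> in the mixed moment cancels
  against the product of the means up to multiples of \<open>\<epsilon> t\<close>, the moment of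
  order \<open>\<beta> - 1\<close>.
\<close>

lemma Q_covariance_limit:
  assumes s: "0 < s"
  shows "((\<lambda>t. covariance M (\<lambda>\<omega>. real (Q s \<omega>)) (\<lambda>\<omega>. real (Q t \<omega>)))
      \<longlongrightarrow> A * G \<beta> s + B / 2 * G (2 * \<beta>) s) at_top"
proof -
  define C where "C = A * G \<beta> s + B / 2 * G (2 * \<beta>) s"
  define \<epsilon> where "\<epsilon> t = G (\<beta> - 1) (t - s)" for t
  have shift: "filterlim (\<lambda>t. t - s) at_top at_top"
    by real_asymp
  have \<epsilon>: "(\<epsilon> \<longlongrightarrow> 0) at_top"
    unfolding \<epsilon>_def by (rule filterlim_compose[OF gamma_moment_asymptotics(3)[OF \<alpha> p \<beta>] shift])
  have late: "eventually (\<lambda>t. s < t \<and> 0 < p * (t - s) + (\<beta> - 1)) at_top"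
    \<comment> \<open>beyond lag \<open>1 / p\<close> the shape exceeds 1 and the moment of order \<open>\<beta> - 1\<close> exists\<close>
    using eventually_gt_at_top[of "s + 1 / p"]
  proof eventually_elim
    case (elim t)
    then have "1 < p * (t - s)"
      using p by (simp add: field_simps)
    then have "0 < p * (t - s)" "0 < p * (t - s) + (\<beta> - 1)"
      using \<beta> by auto
    then show ?case
      using p by (simp add: zero_less_mult_iff)
  qed
  have bounds: "eventually (\<lambda>t.
      C - A\<^sup>2 * (G \<beta> s * (G 1 s * \<epsilon> t)) \<le> covariance M (\<lambda>\<omega>. real (Q s \<omega>)) (\<lambda>\<omega>. real (Q t \<omega>)) \<and>
      covariance M (\<lambda>\<omega>. real (Q s \<omega>)) (\<lambda>\<omega>. real (Q t \<omega>)) \<le> C + A\<^sup>2 * (G (\<beta> + 1) s * \<epsilon> t)) at_top"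
    using late
  proof eventually_elim
    case (elim t)
    then have st: "s < t" and neg: "0 < p * (t - s) + (\<beta> - 1)"
      by auto
    have t: "0 < t" using s st by simp
    have Gs: "0 \<le> A\<^sup>2 * G \<beta> s"
      using G_pos[OF s] moment_positivity[OF s] by (simp add: less_imp_le)
    have "A\<^sup>2 * G \<beta> s * G \<beta> (t - s) \<le> A\<^sup>2 * G \<beta> s * G \<beta> t"
      using G_increment_bounds(1)[OF \<beta> s st] Gs by (rule mult_left_mono)
    moreover have "A\<^sup>2 * G \<beta> s * G \<beta> t \<le> A\<^sup>2 * G \<beta> s * (G \<beta> (t - s) + G 1 s * \<epsilon> t)"
      unfolding \<epsilon>_def using G_increment_bounds(2)[OF \<beta> s st neg] Gs by (rule mult_left_mono)
    ultimately show ?case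
      using Q_product_moment(1)[OF s st] Q_product_moment(2)[OF s st neg]
      unfolding Q_covariance[OF s t] C_def \<epsilon>_def by (simp add: algebra_simps)
  qed
  show ?thesis
    unfolding C_def[symmetric]
  proof (rule tendsto_sandwich)
    show "eventually (\<lambda>t. C - A\<^sup>2 * (G \<beta> s * (G 1 s * \<epsilon> t)) \<le>
        covariance M (\<lambda>\<omega>. real (Q s \<omega>)) (\<lambda>\<omega>. real (Q t \<omega>))) at_top"
      using bounds by eventually_elim simp
    show "eventually (\<lambda>t. covariance M (\<lambda>\<omega>. real (Q s \<omega>)) (\<lambda>\<omega>. real (Q t \<omega>)) \<le>
        C + A\<^sup>2 * (G (\<beta> + 1) s * \<epsilon> t)) at_top"
      using bounds by eventually_elim simp
    have "((\<lambda>t. C - A\<^sup>2 * (G \<beta> s * (G 1 s * \<epsilon> t))) \<longlongrightarrow> C - A\<^sup>2 * (G \<beta> s * (G 1 s * 0))) at_top"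
      by (intro tendsto_intros \<epsilon>)
    then show "((\<lambda>t. C - A\<^sup>2 * (G \<beta> s * (G 1 s * \<epsilon> t))) \<longlongrightarrow> C) at_top"
      by simp
    have "((\<lambda>t. C + A\<^sup>2 * (G (\<beta> + 1) s * \<epsilon> t)) \<longlongrightarrow> C + A\<^sup>2 * (G (\<beta> + 1) s * 0)) at_top"
      by (intro tendsto_intros \<epsilon>)
    then show "((\<lambda>t. C + A\<^sup>2 * (G (\<beta> + 1) s * \<epsilon> t)) \<longlongrightarrow> C) at_top"
      by simp
  qed
qed

text \<open>
  The linear term has order \<open>t powr \<beta>\<close> only; the two terms of order \<open>t
  powr (2 * \<beta>)\<close> do not cancel since \<open>A\<^sup>2 < B\<close>.
\<close>

lemma Q_variance_growth:
  "((\<lambda>t. variance (\<lambda>\<omega>. real (Q t \<omega>)) / t powr (2 * \<beta>)) \<longlongrightarrow> (B - A\<^sup>2) * (p / \<alpha>) powr (2 * \<beta>)) at_top"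
proof -
  note asymp = gamma_moment_asymptotics[OF \<alpha> p \<beta>]
  have small: "((\<lambda>t::real. t powr (- \<beta>)) \<longlongrightarrow> 0) at_top"
    using \<beta> by real_asymp
  have "((\<lambda>t. A * (G \<beta> t / t powr \<beta>) * t powr (- \<beta>) + B * (G (2 * \<beta>) t / t powr (2 * \<beta>)) -
      A\<^sup>2 * (G \<beta> t / t powr \<beta>)\<^sup>2)
    \<longlongrightarrow> A * (p / \<alpha>) powr \<beta> * 0 + B * (p / \<alpha>) powr (2 * \<beta>) - A\<^sup>2 * ((p / \<alpha>) powr \<beta>)\<^sup>2) at_top"
    by (intro tendsto_intros asymp small)
  moreover have "eventually (\<lambda>t. A * (G \<beta> t / t powr \<beta>) * t powr (- \<beta>) + B * (G (2 * \<beta>) t / t powr (2 * \<beta>)) -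
      A\<^sup>2 * (G \<beta> t / t powr \<beta>)\<^sup>2 = variance (\<lambda>\<omega>. real (Q t \<omega>)) / t powr (2 * \<beta>)) at_top"
    using eventually_gt_at_top[of 0]
  proof eventually_elim
    case (elim t)
    have "t powr (2 * \<beta>) = t powr \<beta> * t powr \<beta>"
      by (simp add: powr_add[symmetric])
    then show ?case
      using elim unfolding Q_variance[OF elim]
      by (simp add: powr_minus divide_inverse power2_eq_square algebra_simps)
  qed
  ultimately have "((\<lambda>t. variance (\<lambda>\<omega>. real (Q t \<omega>)) / t powr (2 * \<beta>))
    \<longlongrightarrow> A * (p / \<alpha>) powr \<beta> * 0 + B * (p / \<alpha>) powr (2 * \<beta>) - A\<^sup>2 * ((p / \<alpha>) powr \<beta>)\<^sup>2) at_top"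
    by (rule Lim_transform_eventually)
  moreover have "((p / \<alpha>) powr \<beta>)\<^sup>2 = (p / \<alpha>) powr (2 * \<beta>)"
    by (simp add: power2_eq_square powr_add[symmetric])
  ultimately show ?thesis
    by (simp add: left_diff_distrib)
qed

lemma Q_long_range_dependent: "long_range_dependent M (\<lambda>t \<omega>. real (Q t \<omega>))"
  unfolding long_range_dependent_def correlation_decay_def
proof (rule exI[of _ \<beta>], intro conjI allI impI)
  show "0 < \<beta>" "\<beta> \<in> {0<..<1}"
    using \<beta> by auto
  fix s :: real assume s: "0 < s"
  define V where "V t = variance (\<lambda>\<omega>. real (Q t \<omega>))" for t
  define C where "C = A * G \<beta> s + B / 2 * G (2 * \<beta>) s"
  define v where "v = (B - A\<^sup>2) * (p / \<alpha>) powr (2 * \<beta>)"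
  have C: "0 < C"
    unfolding C_def using A B_pos G_pos[OF s] moment_positivity[OF s]
    by (intro add_nonneg_pos mult_nonneg_nonneg mult_pos_pos) (auto intro: less_imp_le)
  have v: "0 < v"
    unfolding v_def using AB p \<alpha> by simp
  have Vs: "0 < V s"
    unfolding V_def by (rule Q_variance_pos[OF s])
  have "((\<lambda>t. covariance M (\<lambda>\<omega>. real (Q s \<omega>)) (\<lambda>\<omega>. real (Q t \<omega>)) / sqrt (V s * (V t / t powr (2 * \<beta>))))
      \<longlongrightarrow> C / sqrt (V s * v)) at_top"
    unfolding C_def V_def v_def
    by (intro tendsto_intros Q_covariance_limit[OF s] Q_variance_growth)
       (use Vs AB p \<alpha> in \<open>simp add: V_def\<close>)
  moreover have "eventually (\<lambda>t.
      covariance M (\<lambda>\<omega>. real (Q s \<omega>)) (\<lambda>\<omega>. real (Q t \<omega>)) / sqrt (V s * (V t / t powr (2 * \<beta>))) =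
      correlation M (\<lambda>\<omega>. real (Q s \<omega>)) (\<lambda>\<omega>. real (Q t \<omega>)) / t powr (- \<beta>)) at_top"
    using eventually_gt_at_top[of 0]
  proof eventually_elim
    case (elim t)
    have "t powr (2 * \<beta>) = (t powr \<beta>)\<^sup>2"
      by (simp add: power2_eq_square powr_add[symmetric])
    then have "sqrt (V s * (V t / t powr (2 * \<beta>))) = sqrt (V s * V t) / t powr \<beta>"
      by (simp add: real_sqrt_mult real_sqrt_divide)
    then show ?case
      using elim by (simp add: correlation_def V_def powr_minus divide_inverse mult_ac)
  qed
  ultimately have "((\<lambda>t. correlation M (\<lambda>\<omega>. real (Q s \<omega>)) (\<lambda>\<omega>. real (Q t \<omega>)) / t powr (- \<beta>))
      \<longlongrightarrow> C / sqrt (V s * v)) at_top"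
    by (rule Lim_transform_eventually)
  moreover have "0 < C / sqrt (V s * v)"
    using C Vs v by simp
  ultimately show "\<exists>c>0. ((\<lambda>t. correlation M (\<lambda>\<omega>. real (Q s \<omega>)) (\<lambda>\<omega>. real (Q t \<omega>)) / t powr (- \<beta>))
      \<longlongrightarrow> c) at_top"
    by blast
qed

end

theorem theorem4:
  fixes M :: "'a measure" and L :: "'b measure"
    and N\<^sub>\<beta> Q\<^sub>\<beta> :: "real \<Rightarrow> 'a \<Rightarrow> nat" and Y :: "real \<Rightarrow> 'a \<Rightarrow> real"
    and \<beta> rate \<alpha> p :: real
  assumes "0 < \<beta>" "\<beta> < 1" "rate > 0" "\<alpha> > 0" "p > 0"
    and "prob_space M" and "prob_space L"
    and "fractional_poisson_process \<beta> rate L M N\<^sub>\<beta>"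
    and "gamma_subordinator \<alpha> p M Y"
    and "independent_processes M (\<lambda>t \<omega>. real (N\<^sub>\<beta> t \<omega>)) Y"
    and "time_change M N\<^sub>\<beta> Y Q\<^sub>\<beta>"
  shows "long_range_dependent M (\<lambda>t \<omega>. real (Q\<^sub>\<beta> t \<omega>))"
proof -
  interpret gamma_process M \<alpha> p Y
    using assms by (simp add: gamma_process_def gamma_process_axioms_def)
  obtain A B where moments: "0 \<le> A" "A\<^sup>2 < B"
      "\<And>t. 0 < t \<Longrightarrow> (\<integral>\<^sup>+\<omega>. ennreal (real (N\<^sub>\<beta> t \<omega>)) \<partial>M) = ennreal (A * t powr \<beta>)"
      "\<And>t. 0 < t \<Longrightarrow> (\<integral>\<^sup>+\<omega>. ennreal ((real (N\<^sub>\<beta> t \<omega>))\<^sup>2) \<partial>M) =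
           ennreal (A * t powr \<beta> + B * t powr (2 * \<beta>))"
      "\<And>s t. 0 < s \<Longrightarrow> s < t \<Longrightarrow>
           ennreal (A * s powr \<beta> + B / 2 * s powr (2 * \<beta>) + A\<^sup>2 * (s powr \<beta> * (t - s) powr \<beta>))
           \<le> (\<integral>\<^sup>+\<omega>. ennreal (real (N\<^sub>\<beta> s \<omega>) * real (N\<^sub>\<beta> t \<omega>)) \<partial>M)"
      "\<And>s t. 0 < s \<Longrightarrow> s < t \<Longrightarrow>
           (\<integral>\<^sup>+\<omega>. ennreal (real (N\<^sub>\<beta> s \<omega>) * real (N\<^sub>\<beta> t \<omega>)) \<partial>M)
           \<le> ennreal (A * s powr \<beta> + B / 2 * s powr (2 * \<beta>) + A\<^sup>2 * (s powr \<beta> * t powr \<beta>))"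
    using fractional_poisson_moments[OF assms(1-3,7,8)] by blast
  interpret gamma_time_change M \<alpha> p Y \<beta> A B N\<^sub>\<beta> Q\<^sub>\<beta>
  proof
    show "0 < \<beta>" "\<beta> < 1" by fact+
    show "Q\<^sub>\<beta> t \<in> measurable M (count_space UNIV)" if "0 \<le> t" for t
      using assms(11) that by (simp add: time_change_def process_def)
    show "(\<integral>\<^sup>+\<omega>. h (Q\<^sub>\<beta> s \<omega>) (Q\<^sub>\<beta> t \<omega>) \<partial>M) =
        (\<integral>\<^sup>+\<omega>. (\<integral>\<^sup>+\<omega>'. h (N\<^sub>\<beta> (Y s \<omega>) \<omega>') (N\<^sub>\<beta> (Y t \<omega>) \<omega>') \<partial>M) \<partial>M)" if "0 < s" "0 < t" for s t h
    proof (rule nn_integral_time_change[OF assms(6,10) _ assms(11)])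
      show "right_continuous_paths M N\<^sub>\<beta>"
        using assms(8) by (simp add: fractional_poisson_process_def)
      show "AE \<omega> in M. 0 \<le> Y s \<omega>" "AE \<omega> in M. 0 \<le> Y t \<omega>"
        using Y_pos[OF that(1)] Y_pos[OF that(2)] by (auto elim: eventually_mono)
    qed (use that in auto)
  qed (rule moments; assumption)+
  show ?thesis
    by (rule Q_long_range_dependent)
qed

end
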